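(* Let $k(x)\in\mathbb{R}[[x]]$ have nonzero constant term and nonzero coefficient of $x$, let $\mu\in\mathbb{R}^*=\mathbb{R}\setminus\{0\}$, and let $h(x)=\mu\frac{d}{dx}\big(1/k(x)\big)\in\mathbb{R}[[x]]$. Let $K(x,t)=k(x)h(t)$ and define linear operators on $\mathbb{R}[[x]]$ by $$D_K(f)(x):=\frac{1}{h(x)}\left(\frac{f(x)}{k(x)}\right)',\qquad P_K(f)(x):=k(x)\int_0^xh(t)f(t)\,dt$$ (term-by-term differentiation and integration). Put $\mathbb{R}[[x]]_n:=x^n\mathbb{R}[[x]]$ for $n\ge0$ and let $i_{\mathbb{R}[[x]]}:\mathbb{R}\to\mathbb{R}[[x]]$ be the natural inclusion. Then the quintuple $(\mathbb{R}[[x]],\mathbb{R}[[x]]_n,D_K,P_K,i_{\mathbb{R}[[x]]})$ is a compatible differential Reynolds algebra over the unit-modified differential algebra $(\mathbb{R},\mu^{-1}\mathrm{id}_{\mathbb{R}})$, and it is isomorphic, as a compatible differential Reynolds algebra over $(\mathbb{R},\mu^{-1}\mathrm{id}_{\mathbb{R}})$, to the free commutative compatible differential Reynolds algebra $S(\mathbb{R})$ over $(\mathbb{R},\mu^{-1}\mathrm{id}_{\mathbb{R}})$.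
   Context: Definitions are for a base field $\mathbf{k}$ of characteristic $0$ and are used here with $\mathbf{k}=\mathbb{R}$, $(A,d)=(\mathbb{R},\mu^{-1}\mathrm{id}_{\mathbb{R}})$. All algebras are unitary associative commutative $\mathbf{k}$-algebras; tensor products are over $\mathbf{k}$; "linear" means $\mathbf{k}$-linear. A unit-modified differential algebra is a pair $(R,D)$ with $R$ an algebra and $D:R\to R$ linear with $D(xy)=D(x)y+xD(y)-xD(1_R)y$ for all $x,y\in R$. A differential Reynolds algebra is a triple $(R,D,P)$ where $(R,D)$ is a unit-modified differential algebra and $P:R\to R$ is linear with $DP=\mathrm{id}_R$ and $P(x)P(y)=P(P(x)y)+P(xP(y))-P(P(x)D(1_R)P(y))$ for all $x,y\in R$. An operated $A$-module is a pair $(R,P)$ of an $A$-module $R$ and a $\mathbf{k}$-linear operator $P$ on $R$; an operated submodule is an $A$-submodule stable under $P$. A complete operated $A$-module is a triple $(R,R_n,P)$ with $(R,P)$ an operated $A$-module and $\{R_n\}_{n\ge0}$ a decreasing filtration by operated $A$-submodules such that the natural map $R\to\varprojlim R/R_n$ is an isomorphism. For such a triple put $\overline{\mathrm{Fil}}^0_PR:=R$ and $\overline{\mathrm{Fil}}^n_PR:=\mathrm{cl}\big(A\,P(\overline{\mathrm{Fil}}^{n-1}_PR)\big)$ for $n\ge1$, where $A\,P(N)$ is the $A$-submodule generated by $P(N)$ and $\mathrm{cl}$ is closure in the topology defined by $\{R_n\}$. The triple is a compatible complete operated $A$-module if $R_n=\overline{\mathrm{Fil}}^n_PR$ for all $n\ge0$.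 A compatible differential Reynolds algebra over $(A,d)$ is a quintuple $(R,R_n,D,P,i_R)$ where $R$ is an $A$-algebra with structure map $i_R:A\to R$ satisfying $i_Rd=Di_R$, $(R,D,P)$ is a differential Reynolds algebra, and $(R,R_n,P)$ is a compatible complete operated $A$-module. A morphism $f:(R,R_n,D,P,i_R)\to(R',R'_n,D',P',i_{R'})$ is an algebra homomorphism with $f i_R=i_{R'}$, $fD=D'f$, $fP=P'f$, $f(R_n)\subseteq R'_n$ for all $n$. The free compatible differential Reynolds algebra over $(A,d)$ is the initial object of the resulting category; it is realized by $(S(A),S(A)_n,\diamond,D_S,P_S,j_A)$, constructed as follows. $S(A):=\prod_{k\ge1}A^{\otimes k}$, $S(A)_n:=\prod_{k\ge n+1}A^{\otimes k}$, and $S^+(A):=\mathbf{k}\oplus\prod_{k\ge1}A^{\otimes k}$ (with $A^{\otimes 0}=\mathbf{k}$); $A$ acts on the leftmost tensor factor; all operations are defined on pure tensors and extended (bi)linearly and termwise to formal series. $P_S(\mathfrak a)=1_A\otimes\mathfrak a$; $j_A:A\to S(A)$ is the inclusion of $A^{\otimes1}$. Put $\lambda=d(1_A)$. For $m,n\ge1$ let $S_{m,n}$ be the set of $\sigma\in S_{m+n}$ with $\sigma^{-1}(1)<\cdots<\sigma^{-1}(m)$ and $\sigma^{-1}(m+1)<\cdots<\sigma^{-1}(m+n)$. On $S^+(A)$ let $1_{\mathbf k}\hat\ast\mathfrak a=\mathfrak a\hat\ast1_{\mathbf k}=\mathfrak a$ and, for $\mathfrak a\in A^{\otimes m}$, $\mathfrak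 b\in A^{\otimes n}$ pure tensors, $m,n\ge1$, $c_1\otimes\cdots\otimes c_{m+n}=\mathfrak a\otimes\mathfrak b$, $$\mathfrak a\,\hat\ast\,\mathfrak b=\sum_{\sigma\in S_{m,n}}\sum_{\mathfrak i\in I_\sigma}(-\lambda)^{\otimes i_1}\otimes c_{\sigma(1)}\otimes\cdots\otimes(-\lambda)^{\otimes i_{m+n}}\otimes c_{\sigma(m+n)},$$ where $I_\sigma$ is the set of $\mathfrak i\in\mathbb{N}^{m+n}$ (with $0\in\mathbb N$) such that $i_j=0$ whenever $j>\min\{\sigma^{-1}(m),\sigma^{-1}(m+n)\}$. Then $(a_0\otimes\mathfrak a')\diamond(b_0\otimes\mathfrak b'):=a_0b_0\otimes(\mathfrak a'\hat\ast\mathfrak b')$ (with $\mathfrak a'$ or $\mathfrak b'$ equal to $1_{\mathbf k}$ for tensors of length $1$, and $a\otimes1_{\mathbf k}=a$). Finally $D_S(a_0)=d(a_0)$ and, for $k\ge1$, $D_S(a_0\otimes\cdots\otimes a_k)=d(a_0)\otimes a_1\otimes\cdots\otimes a_k+a_0a_1\otimes a_2\otimes\cdots\otimes a_k-d(1_A)a_0\otimes a_1\otimes\cdots\otimes a_k$. *)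

theory Defs
  imports
    "HOL-Algebra.AbelCoset"
    "HOL-Algebra.Module"
    "HOL-Analysis.Abstract_Topology"
    "HOL-Computational_Algebra.Formal_Power_Series"
    "HOL-Combinatorics.Permutations"
    "HOL-Library.Groups_Big_Fun"
begin

section \<open>Differential Reynolds algebras\<close>

text \<open>
  The base field is a type of class \<^class>\<open>field_char_0\<close>.  The library locale \<^locale>\<open>algebra\<close>
  describes unitary associative commutative algebras.
\<close>

definition base_field :: "'k::field_char_0 ring"
  where "base_field = \<lparr>carrier = UNIV, monoid.mult = (*), one = 1, zero = 0, add = (+)\<rparr>"

abbreviation k_algebra :: "('k::field_char_0, 'r, 'm) module_scheme \<Rightarrow> bool"
  where "k_algebra R \<equiv> algebra (base_field :: 'k ring) R"

definition k_linear ::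
  "('k::field_char_0, 'r, 'm) module_scheme \<Rightarrow> ('k, 's, 'n) module_scheme \<Rightarrow> ('r \<Rightarrow> 's) \<Rightarrow> bool"
  where "k_linear M N f \<longleftrightarrow>
    f \<in> carrier M \<rightarrow> carrier N \<and>
    (\<forall>x\<in>carrier M. \<forall>y\<in>carrier M. f (x \<oplus>\<^bsub>M\<^esub> y) = f x \<oplus>\<^bsub>N\<^esub> f y) \<and>
    (\<forall>c. \<forall>x\<in>carrier M. f (c \<odot>\<^bsub>M\<^esub> x) = c \<odot>\<^bsub>N\<^esub> f x)"

definition unit_modified_differential_algebra ::
  "('k::field_char_0, 'r, 'm) module_scheme \<Rightarrow> ('r \<Rightarrow> 'r) \<Rightarrow> bool"
  where "unit_modified_differential_algebra R D \<longleftrightarrow>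
    k_algebra R \<and> k_linear R R D \<and>
    (\<forall>x\<in>carrier R. \<forall>y\<in>carrier R.
      D (x \<otimes>\<^bsub>R\<^esub> y) = ((D x \<otimes>\<^bsub>R\<^esub> y) \<oplus>\<^bsub>R\<^esub> (x \<otimes>\<^bsub>R\<^esub> D y)) \<ominus>\<^bsub>R\<^esub> ((x \<otimes>\<^bsub>R\<^esub> D \<one>\<^bsub>R\<^esub>) \<otimes>\<^bsub>R\<^esub> y))"

definition differential_reynolds_algebra ::
  "('k::field_char_0, 'r, 'm) module_scheme \<Rightarrow> ('r \<Rightarrow> 'r) \<Rightarrow> ('r \<Rightarrow> 'r) \<Rightarrow> bool"
  where "differential_reynolds_algebra R D P \<longleftrightarrow>
    unit_modified_differential_algebra R D \<and> k_linear R R P \<and>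
    (\<forall>x\<in>carrier R. D (P x) = x) \<and>
    (\<forall>x\<in>carrier R. \<forall>y\<in>carrier R.
      P x \<otimes>\<^bsub>R\<^esub> P y =
        (P (P x \<otimes>\<^bsub>R\<^esub> y) \<oplus>\<^bsub>R\<^esub> P (x \<otimes>\<^bsub>R\<^esub> P y)) \<ominus>\<^bsub>R\<^esub> P ((P x \<otimes>\<^bsub>R\<^esub> D \<one>\<^bsub>R\<^esub>) \<otimes>\<^bsub>R\<^esub> P y))"


section \<open>Complete operated modules\<close>

definition restrict_scalars ::
  "('k, 'a, 'm) module_scheme \<Rightarrow> ('a, 'r, 'n) module_scheme \<Rightarrow> ('k, 'r) module"
  where "restrict_scalars A M =
    \<lparr>carrier = carrier M, monoid.mult = monoid.mult M, one = \<one>\<^bsub>M\<^esub>, zero = \<zero>\<^bsub>M\<^esub>, add = add M,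
     module.smult = (\<lambda>c x. (c \<odot>\<^bsub>A\<^esub> \<one>\<^bsub>A\<^esub>) \<odot>\<^bsub>M\<^esub> x)\<rparr>"

definition operated_module ::
  "('k::field_char_0, 'a, 'm) module_scheme \<Rightarrow> ('a, 'r, 'n) module_scheme \<Rightarrow> ('r \<Rightarrow> 'r) \<Rightarrow> bool"
  where "operated_module A M P \<longleftrightarrow>
    k_algebra A \<and> Module.module A M \<and> k_linear (restrict_scalars A M) (restrict_scalars A M) P"

definition operated_submodule ::
  "('k, 'a, 'm) module_scheme \<Rightarrow> ('a, 'r, 'n) module_scheme \<Rightarrow> ('r \<Rightarrow> 'r) \<Rightarrow> 'r set \<Rightarrow> bool"
  where "operated_submodule A M P N \<longleftrightarrow> submodule N A M \<and> P ` N \<subseteq> N"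

definition filtration_topology :: "('a, 'r, 'n) module_scheme \<Rightarrow> (nat \<Rightarrow> 'r set) \<Rightarrow> 'r topology"
  where "filtration_topology M F =
    topology_generated_by {F n +>\<^bsub>M\<^esub> x | n x. x \<in> carrier M}"

text \<open>
  Elements of the inverse limit of the quotients \<open>M / F n\<close> are families of cosets; the transition
  map from \<open>M / F n\<close> to \<open>M / F m\<close>, for \<open>m \<le> n\<close>, sends a coset \<open>C\<close> to \<open>F m + C\<close>.
\<close>

definition inverse_limit :: "('a, 'r, 'n) module_scheme \<Rightarrow> (nat \<Rightarrow> 'r set) \<Rightarrow> (nat \<Rightarrow> 'r set) set"
  where "inverse_limit M F =
    {C. (\<forall>n. C n \<in> A_RCOSETS M (F n)) \<and> (\<forall>m n. m \<le> n \<longrightarrow> C m = F m <+>\<^bsub>M\<^esub> C n)}"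

text \<open>
  The natural map into the inverse limit is always a homomorphism, hence it is an isomorphism
  as soon as it is bijective.
\<close>

definition complete_operated_module ::
  "('k::field_char_0, 'a, 'm) module_scheme \<Rightarrow> ('a, 'r, 'n) module_scheme
    \<Rightarrow> (nat \<Rightarrow> 'r set) \<Rightarrow> ('r \<Rightarrow> 'r) \<Rightarrow> bool"
  where "complete_operated_module A M F P \<longleftrightarrow>
    operated_module A M P \<and> (\<forall>n. operated_submodule A M P (F n)) \<and> decseq F \<and>
    bij_betw (\<lambda>x n. F n +>\<^bsub>M\<^esub> x) (carrier M) (inverse_limit M F)"

definition generated_submodule ::
  "('k, 'a, 'm) module_scheme \<Rightarrow> ('a, 'r, 'n) module_scheme \<Rightarrow> 'r set \<Rightarrow> 'r set"
  where "generated_submodule A M Y = \<Inter>{N. submodule N A M \<and> Y \<subseteq> N}"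

primrec closed_operator_filtration ::
  "('k, 'a, 'm) module_scheme \<Rightarrow> ('a, 'r, 'n) module_scheme
    \<Rightarrow> (nat \<Rightarrow> 'r set) \<Rightarrow> ('r \<Rightarrow> 'r) \<Rightarrow> nat \<Rightarrow> 'r set"
  where
    "closed_operator_filtration A M F P 0 = carrier M"
  | "closed_operator_filtration A M F P (Suc n) =
      filtration_topology M F closure_of
        generated_submodule A M (P ` closed_operator_filtration A M F P n)"

definition compatible_complete_operated_module ::
  "('k::field_char_0, 'a, 'm) module_scheme \<Rightarrow> ('a, 'r, 'n) module_scheme
    \<Rightarrow> (nat \<Rightarrow> 'r set) \<Rightarrow> ('r \<Rightarrow> 'r) \<Rightarrow> bool"
  where "compatible_complete_operated_module A M F P \<longleftrightarrow>
    complete_operated_module A M F P \<and> (\<forall>n. F n = closed_operator_filtration A M F P n)"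


section \<open>Compatible differential Reynolds algebras\<close>

record ('k, 'a, 'r) cdr_algebra = "('k, 'r) module" +
  filt :: "nat \<Rightarrow> 'r set"
  der :: "'r \<Rightarrow> 'r"
  rey :: "'r \<Rightarrow> 'r"
  str :: "'a \<Rightarrow> 'r"

definition structure_module :: "('k, 'a, 'r) cdr_algebra \<Rightarrow> ('a, 'r) module"
  where "structure_module R =
    \<lparr>carrier = carrier R, monoid.mult = monoid.mult R, one = \<one>\<^bsub>R\<^esub>, zero = \<zero>\<^bsub>R\<^esub>, add = add R,
     module.smult = (\<lambda>a x. str R a \<otimes>\<^bsub>R\<^esub> x)\<rparr>"

definition algebra_hom ::
  "('k::field_char_0, 'r, 'm) module_scheme \<Rightarrow> ('k, 's, 'n) module_scheme \<Rightarrow> ('r \<Rightarrow> 's) set"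
  where "algebra_hom R R' = {f \<in> ring_hom R R'. k_linear R R' f}"

definition compatible_differential_reynolds_algebra ::
  "('k::field_char_0, 'a) module \<Rightarrow> ('a \<Rightarrow> 'a) \<Rightarrow> ('k, 'a, 'r) cdr_algebra \<Rightarrow> bool"
  where "compatible_differential_reynolds_algebra A d R \<longleftrightarrow>
    unit_modified_differential_algebra A d \<and>
    differential_reynolds_algebra R (der R) (rey R) \<and>
    str R \<in> algebra_hom A R \<and>
    (\<forall>a\<in>carrier A. str R (d a) = der R (str R a)) \<and>
    compatible_complete_operated_module A (structure_module R) (filt R) (rey R)"

definition cdr_hom ::
  "('k::field_char_0, 'a) module \<Rightarrow> ('k, 'a, 'r) cdr_algebra \<Rightarrow> ('k, 'a, 's) cdr_algebra
    \<Rightarrow> ('r \<Rightarrow> 's) set"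
  where "cdr_hom A R R' =
    {f \<in> algebra_hom R R'.
      (\<forall>a\<in>carrier A. f (str R a) = str R' a) \<and>
      (\<forall>x\<in>carrier R. f (der R x) = der R' (f x)) \<and>
      (\<forall>x\<in>carrier R. f (rey R x) = rey R' (f x)) \<and>
      (\<forall>n. f ` filt R n \<subseteq> filt R' n)}"

definition cdr_isomorphic ::
  "('k::field_char_0, 'a) module \<Rightarrow> ('k, 'a, 'r) cdr_algebra \<Rightarrow> ('k, 'a, 's) cdr_algebra \<Rightarrow> bool"
  where "cdr_isomorphic A R R' \<longleftrightarrow>
    (\<exists>f\<in>cdr_hom A R R'. \<exists>g\<in>cdr_hom A R' R.
      (\<forall>x\<in>carrier R. g (f x) = x) \<and> (\<forall>y\<in>carrier R'. f (g y) = y))"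


section \<open>The construction \<open>S(A)\<close> for \<open>A = \<real>\<close>\<close>

text \<open>
  The tensor power of \<open>k\<close> copies of \<open>\<real>\<close> over \<open>\<real>\<close> is realized on \<open>\<real>\<close>, the pure tensor of
  \<open>c\<^sub>1, \<dots>, c\<^sub>k\<close> being the product of these numbers.  The following lemma is the universal property
  that justifies this.
\<close>

lemma real_tensor_power_universal:
  fixes \<phi> :: "real list \<Rightarrow> 'v::real_vector"
  assumes add: "\<And>xs ys a b. Suc (length xs + length ys) = k \<Longrightarrow>
      \<phi> (xs @ (a + b) # ys) = \<phi> (xs @ a # ys) + \<phi> (xs @ b # ys)"
    and scale: "\<And>xs ys a c. Suc (length xs + length ys) = k \<Longrightarrow>
      \<phi> (xs @ (c * a) # ys) = c *\<^sub>R \<phi> (xs @ a # ys)"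
  shows "\<exists>!g. linear g \<and> (\<forall>cs. length cs = k \<longrightarrow> \<phi> cs = g (prod_list cs))"
proof -
  have step: "\<phi> (replicate n 1 @ cs) = prod_list cs *\<^sub>R \<phi> (replicate k 1)"
    if "n + length cs = k" for n cs
    using that
  proof (induction cs arbitrary: n)
    case Nil
    then show ?case by simp
  next
    case (Cons c cs)
    have "\<phi> (replicate n 1 @ (c * 1) # cs) = c *\<^sub>R \<phi> (replicate n 1 @ 1 # cs)"
      by (rule scale) (use Cons.prems in simp)
    also have "\<phi> (replicate n 1 @ 1 # cs) = \<phi> (replicate (Suc n) 1 @ cs)"
      by (simp add: replicate_app_Cons_same)
    also have "\<dots> = prod_list cs *\<^sub>R \<phi> (replicate k 1)"
      by (rule Cons.IH) (use Cons.prems in simp)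
    finally show ?case by simp
  qed
  show ?thesis
  proof (rule ex1I[where a = "\<lambda>c. c *\<^sub>R \<phi> (replicate k 1)"])
    have "linear (\<lambda>c. c *\<^sub>R \<phi> (replicate k 1))"
      by (rule linearI) (simp_all add: scaleR_add_left)
    moreover have "\<phi> cs = prod_list cs *\<^sub>R \<phi> (replicate k 1)" if "length cs = k" for cs
      using step[of 0 cs] that by (simp only: add_0 append_Nil replicate_0)
    ultimately show "linear (\<lambda>c. c *\<^sub>R \<phi> (replicate k 1)) \<and>
        (\<forall>cs. length cs = k \<longrightarrow> \<phi> cs = prod_list cs *\<^sub>R \<phi> (replicate k 1))"
      by blast
  next
    fix g :: "real \<Rightarrow> 'v"
    assume g: "linear g \<and> (\<forall>cs. length cs = k \<longrightarrow> \<phi> cs = g (prod_list cs))"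
    have one: "\<phi> (replicate k 1) = g 1"
      using conjunct2[OF g, THEN spec, of "replicate k 1"] by (simp add: prod_list_replicate)
    have "g c = c *\<^sub>R g 1" for c
      using linear_scale[OF conjunct1[OF g], of c 1] by simp
    then show "g = (\<lambda>c. c *\<^sub>R \<phi> (replicate k 1))"
      unfolding one by (rule ext)
  qed
qed

text \<open>
  Formal series of tensors, i.e. elements of \<open>S\<^sup>+(\<real>)\<close>: the value at \<open>k\<close> is the component of tensor
  length \<open>k\<close>.  The elements of \<open>S(\<real>)\<close> are those whose component of length \<open>0\<close> vanishes.
\<close>

type_synonym tseries = "nat \<Rightarrow> real"

definition ptensor :: "real list \<Rightarrow> tseries"
  where "ptensor cs = (\<lambda>k. if k = length cs then prod_list cs else 0)"

text \<open>
  Linear and bilinear extension, termwise on formal series, of operations given on pure tensors: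
  the tensors \<open>1 \<otimes> \<dots> \<otimes> 1\<close> are bases of the tensor powers.  For all operations below the sums have
  only finitely many nonzero terms in each component.
\<close>

definition lin_ext :: "(real list \<Rightarrow> tseries) \<Rightarrow> tseries \<Rightarrow> tseries"
  where "lin_ext T s = (\<lambda>k. Sum_any (\<lambda>m. s m * T (replicate m 1) k))"

definition bilin_ext :: "(real list \<Rightarrow> real list \<Rightarrow> tseries) \<Rightarrow> tseries \<Rightarrow> tseries \<Rightarrow> tseries"
  where "bilin_ext B s t = (\<lambda>k. Sum_any (\<lambda>(m, n). s m * t n * B (replicate m 1) (replicate n 1) k))"

definition shuffle_perms :: "nat \<Rightarrow> nat \<Rightarrow> (nat \<Rightarrow> nat) set"
  where "shuffle_perms m n =
    {\<sigma>. \<sigma> permutes {1..m + n} \<and> strict_mono_on {1..m} (inv_into UNIV \<sigma>) \<and>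
        strict_mono_on {m + 1..m + n} (inv_into UNIV \<sigma>)}"

text \<open>Tuples indexed by \<open>1, \<dots>, m + n\<close> are functions vanishing at the other indices.\<close>

definition insertion_indices :: "nat \<Rightarrow> nat \<Rightarrow> (nat \<Rightarrow> nat) \<Rightarrow> (nat \<Rightarrow> nat) set"
  where "insertion_indices m n \<sigma> =
    {i. (\<forall>j. j \<notin> {1..m + n} \<longrightarrow> i j = 0) \<and>
        (\<forall>j\<in>{1..m + n}. j > min (inv_into UNIV \<sigma> m) (inv_into UNIV \<sigma> (m + n)) \<longrightarrow> i j = 0)}"

definition shuffle_word :: "real \<Rightarrow> real list \<Rightarrow> (nat \<Rightarrow> nat) \<Rightarrow> (nat \<Rightarrow> nat) \<Rightarrow> real list"
  where "shuffle_word l cs \<sigma> i =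
    concat (map (\<lambda>j. replicate (i j) (- l) @ [cs ! (\<sigma> j - 1)]) [1..<length cs + 1])"

text \<open>The infinite sum over the insertion indices is collected by tensor length.\<close>

definition mod_shuffle :: "real \<Rightarrow> real list \<Rightarrow> real list \<Rightarrow> tseries"
  where "mod_shuffle l as bs =
    (if as = [] then ptensor bs else if bs = [] then ptensor as
     else (\<lambda>k. \<Sum>\<sigma>\<in>shuffle_perms (length as) (length bs).
       \<Sum>i\<in>{i \<in> insertion_indices (length as) (length bs) \<sigma>.
              length (shuffle_word l (as @ bs) \<sigma> i) = k}.
         ptensor (shuffle_word l (as @ bs) \<sigma> i) k))"

text \<open>
  The operations of \<open>S(\<real>)\<close> on pure tensors of positive length; their values at the empty list
  are irrelevant.  Here \<open>d\<close> is the linear operator of the base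
  algebra \<open>\<real>\<close>.
\<close>

fun diamond :: "(real \<Rightarrow> real) \<Rightarrow> real list \<Rightarrow> real list \<Rightarrow> tseries"
  where
    "diamond d (a # as) (b # bs) = lin_ext (\<lambda>ws. ptensor (a * b # ws)) (mod_shuffle (d 1) as bs)"
  | "diamond d [] bs = (\<lambda>k. 0)"
  | "diamond d as [] = (\<lambda>k. 0)"

fun der_S :: "(real \<Rightarrow> real) \<Rightarrow> real list \<Rightarrow> tseries"
  where
    "der_S d [] = (\<lambda>k. 0)"
  | "der_S d [a] = ptensor [d a]"
  | "der_S d (a # b # cs) =
      (\<lambda>k. ptensor (d a # b # cs) k + ptensor (a * b # cs) k - ptensor (d 1 * a # b # cs) k)"

definition rey_S :: "real list \<Rightarrow> tseries"
  where "rey_S as = ptensor (1 # as)"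

text \<open>The bilinear and linear extensions agree with the given formulas on all pure tensors.\<close>

lemma lin_ext_ptensor:
  assumes "\<And>k. T cs k = prod_list cs * T (replicate (length cs) 1) k"
  shows "lin_ext T (ptensor cs) = T cs"
proof
  fix k
  have "lin_ext T (ptensor cs) k =
      Sum_any (\<lambda>m. if m = length cs then prod_list cs * T (replicate m 1) k else 0)"
    unfolding lin_ext_def ptensor_def by (intro arg_cong[where f = Sum_any] ext) simp
  also have "\<dots> = T cs k"
    by (simp add: assms[of k])
  finally show "lin_ext T (ptensor cs) k = T cs k" .
qed

lemma bilin_ext_ptensor:
  assumes "\<And>k. B as bs k =
      prod_list as * prod_list bs * B (replicate (length as) 1) (replicate (length bs) 1) k"
  shows "bilin_ext B (ptensor as) (ptensor bs) = B as bs"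
proof
  fix k
  have "bilin_ext B (ptensor as) (ptensor bs) k =
      Sum_any (\<lambda>p. if p = (length as, length bs)
        then prod_list as * prod_list bs * B (replicate (fst p) 1) (replicate (snd p) 1) k else 0)"
    unfolding bilin_ext_def ptensor_def
    by (intro arg_cong[where f = Sum_any] ext) (auto split: prod.splits)
  also have "\<dots> = B as bs k"
    by (simp add: assms[of k])
  finally show "bilin_ext B (ptensor as) (ptensor bs) k = B as bs k" .
qed

lemma prod_list_shuffle_word:
  assumes "\<sigma> permutes {1..length cs}"
  shows "prod_list (shuffle_word l cs \<sigma> i) =
    prod_list cs * prod_list (shuffle_word l (replicate (length cs) 1) \<sigma> i)"
proof -
  have word: "prod_list (shuffle_word l ds \<sigma> i) =
      (\<Prod>j\<in>{1..length cs}. (- l) ^ i j) * (\<Prod>j\<in>{1..length cs}. ds ! (\<sigma> j - 1))"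
    if "length ds = length cs" for ds
  proof -
    have "prod_list (concat (map f js)) = prod_list (map (\<lambda>j. prod_list (f j)) js)"
      for f :: "nat \<Rightarrow> real list" and js
      by (induction js) simp_all
    then have "prod_list (shuffle_word l ds \<sigma> i) =
        prod_list (map (\<lambda>j. (- l) ^ i j * ds ! (\<sigma> j - 1)) [1..<length cs + 1])"
      unfolding shuffle_word_def using that by (simp add: prod_list_replicate)
    also have "\<dots> = (\<Prod>j\<in>set [1..<length cs + 1]. (- l) ^ i j * ds ! (\<sigma> j - 1))"
      by (rule prod.distinct_set_conv_list[symmetric]) simp
    also have "set [1..<length cs + 1] = {1..length cs}" by auto
    finally show ?thesis by (simp add: prod.distrib)
  qed
  have perm: "(\<Prod>j\<in>{1..length cs}. ds ! (\<sigma> j - 1)) = prod_list ds"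
    if "length ds = length cs" for ds :: "real list"
  proof -
    have "(\<Prod>j\<in>{1..length cs}. ds ! (\<sigma> j - 1)) = (\<Prod>j\<in>{1..length cs}. ds ! (j - 1))"
      using prod.permute[OF assms, of "\<lambda>j. ds ! (j - 1)"] by (simp add: comp_def)
    also have "\<dots> = (\<Prod>j<length cs. ds ! j)"
      by (rule prod.reindex_bij_witness[where i = Suc and j = "\<lambda>j. j - 1"]) auto
    also have "\<dots> = prod_list ds"
      using that by (simp add: prod.list_conv_set_nth atLeast0LessThan)
    finally show ?thesis .
  qed
  show ?thesis
    using word[of cs] word[of "replicate (length cs) 1"] perm[of cs] perm[of "replicate (length cs) 1"]
    by (simp add: prod_list_replicate)
qed

lemma mod_shuffle_multilinear:
  "mod_shuffle l as bs k =
    prod_list as * prod_list bs * mod_shuffle l (replicate (length as) 1) (replicate (length bs) 1) k"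
proof (cases "as = [] \<or> bs = []")
  case True
  then show ?thesis
    by (auto simp: mod_shuffle_def ptensor_def prod_list_replicate)
next
  case False
  have len: "length (shuffle_word l (replicate (length cs) 1) \<sigma> i) = length (shuffle_word l cs \<sigma> i)"
    for cs \<sigma> i
    by (simp add: shuffle_word_def length_concat comp_def)
  have rep: "replicate (length as) 1 @ replicate (length bs) 1 = replicate (length (as @ bs)) (1::real)"
    by (simp add: replicate_add)
  have "ptensor (shuffle_word l (as @ bs) \<sigma> i) k =
      prod_list as * prod_list bs * ptensor (shuffle_word l (replicate (length (as @ bs)) 1) \<sigma> i) k"
    if "\<sigma> \<in> shuffle_perms (length as) (length bs)" for \<sigma> i
    using that prod_list_shuffle_word[of \<sigma> "as @ bs" l i] len[of "as @ bs" \<sigma> i]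
    by (auto simp: ptensor_def shuffle_perms_def)
  then show ?thesis
    using False len[of "as @ bs"]
    by (auto simp: mod_shuffle_def rep sum_distrib_left intro!: sum.cong simp del: length_append)
qed

lemma diamond_ptensor: "bilin_ext (diamond d) (ptensor as) (ptensor bs) = diamond d as bs"
proof (rule bilin_ext_ptensor)
  fix k
  have cons: "lin_ext (\<lambda>ws. ptensor (c # ws)) s k = (if k = 0 then 0 else c * s (k - 1))" for c s
  proof -
    have "lin_ext (\<lambda>ws. ptensor (c # ws)) s k =
        Sum_any (\<lambda>m. if m = k - 1 then if k = 0 then 0 else c * s m else 0)"
      unfolding lin_ext_def ptensor_def
      by (intro arg_cong[where f = Sum_any] ext) (auto simp: prod_list_replicate)
    also have "\<dots> = (if k = 0 then 0 else c * s (k - 1))" by simp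
    finally show ?thesis .
  qed
  show "diamond d as bs k =
      prod_list as * prod_list bs * diamond d (replicate (length as) 1) (replicate (length bs) 1) k"
    using mod_shuffle_multilinear[of "d 1" "tl as" "tl bs" "k - 1"]
    by (cases as; cases bs) (auto simp: cons)
qed

lemma der_S_ptensor: "lin_ext (der_S d) (ptensor as) = der_S d as" if "linear d"
proof (rule lin_ext_ptensor)
  have d: "d a = a * d 1" for a
    using linear_scale[OF that, of a 1] by simp
  fix k
  show "der_S d as k = prod_list as * der_S d (replicate (length as) 1) k"
    using d[of "hd as"]
    by (cases "(d, as)" rule: der_S.cases) (auto simp: ptensor_def prod_list_replicate algebra_simps)
qed

lemma rey_S_ptensor: "lin_ext rey_S (ptensor as) = rey_S as"
  by (rule lin_ext_ptensor) (simp add: rey_S_def ptensor_def prod_list_replicate)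

definition real_algebra :: "(real, real) module"
  where "real_algebra =
    \<lparr>carrier = UNIV, monoid.mult = (*), one = 1, zero = 0, add = (+), module.smult = (*)\<rparr>"

definition S_real :: "(real \<Rightarrow> real) \<Rightarrow> (real, real, tseries) cdr_algebra"
  where "S_real d =
    \<lparr>carrier = {s. s 0 = 0},
     monoid.mult = bilin_ext (diamond d),
     one = ptensor [1],
     zero = (\<lambda>k. 0),
     add = (\<lambda>s t k. s k + t k),
     module.smult = (\<lambda>c s k. c * s k),
     filt = (\<lambda>n. {s. \<forall>k\<le>n. s k = 0}),
     der = lin_ext (der_S d),
     rey = lin_ext rey_S,
     str = (\<lambda>a. ptensor [a])\<rparr>"


section \<open>Power series with a separable Volterra operator\<close>

text \<open>
  The operator \<open>P_K\<close> has kernel \<open>K(x, t) = k(x) h(t)\<close>; its left inverse is \<open>D_K\<close>.  Both need \<open>k\<close>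
  and \<open>h\<close> to have nonzero constant terms.
\<close>

definition D_K :: "real fps \<Rightarrow> real fps \<Rightarrow> real fps \<Rightarrow> real fps"
  where "D_K k h f = 1 / h * fps_deriv (f / k)"

definition P_K :: "real fps \<Rightarrow> real fps \<Rightarrow> real fps \<Rightarrow> real fps"
  where "P_K k h f = k * fps_integral0 (h * f)"

definition power_series_cdr :: "real fps \<Rightarrow> real fps \<Rightarrow> (real, real, real fps) cdr_algebra"
  where "power_series_cdr k h =
    \<lparr>carrier = UNIV, monoid.mult = (*), one = 1, zero = 0, add = (+),
     module.smult = (\<lambda>c f. fps_const c * f),
     filt = (\<lambda>n. range (\<lambda>g. fps_X ^ n * g)),
     der = D_K k h,
     rey = P_K k h,
     str = fps_const\<rparr>"

end

theory Submission
  imports Defs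
begin

text \<open>
  A series \<open>s\<close> of \<open>S(\<real>)\<close> is \<open>s\<^sub>1 \<cdot> 1 + P_S(s')\<close>, where \<open>s'\<close> is \<open>s\<close> with its first tensor factor removed.  Hence
  a morphism \<open>f\<close> into a compatible algebra \<open>R\<close> must satisfy \<open>f s = s\<^sub>1 \<cdot> 1 + P(f s')\<close>, which determines
  \<open>f s\<close> modulo every \<open>R\<^sub>n\<close>, and completeness of \<open>R\<close> provides such an \<open>f\<close>.  All its properties follow
  by induction modulo \<open>R\<^sub>n\<close>, because \<open>P\<close> maps \<open>R\<^sub>n\<close> into \<open>R\<^bsub>n+1\<^esub>\<close>; no continuity
  of the product or of \<open>D\<close> is needed.  Multiplicativity uses the Reynolds identity of \<open>R\<close> and a
  recursion for the modified shuffle product that splits off the first letter of each shuffle.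

  For \<open>R = \<real>[[x]]\<close> the map \<open>f\<close> is bijective, as \<open>\<real>[[x]] = \<real> \<oplus> P_K(\<real>[[x]])\<close> and \<open>D_K P_K = id\<close>.  The
  algebra laws of \<open>S(\<real>)\<close> are therefore inherited from \<open>\<real>[[x]]\<close>.
\<close>


text \<open>The obstacle is associativity of \<open>diamond\<close>: a direct proof would compare
  threefold shuffles with insertions. The map into a complete algebra is therefore built and shown
  to respect all operations before any algebra law of S(\<real>) is known; the notion of morphism
  only mentions the operations, so nothing is circular. The case R = \<real>[[x]], where the map is
  injective, then gives the laws, and the same map for arbitrary R gives initiality.

  The combinatorics enters through one three-term recursion. The first factor of a modified shuffle
  is the first letter of one word, the first letter of the other, or an inserted -\<lambda>; an
  insertion is allowed exactly while both words still have letters, so after each choice the rest is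
  again a modified shuffle. The three choices are the three terms of P(u)P(v) = P(P(u)v) + P(uP(v))
  - \<lambda> P(P(u)P(v)), since D(1) = \<lambda> 1.

  For power series, the choice of h makes D_K(1) the constant 1/\<mu>, and the unit-modified Leibniz
  rule is the ordinary product rule for fg/k.\<close>

section \<open>The modified shuffle product of powers of the unit tensor\<close>

text \<open>
  On powers of the unit tensor, the insertion indices of a shuffle only matter through their sum \<open>j\<close>
  and through the last position \<open>M\<close> at which they may be nonzero.
\<close>

definition weak_compositions :: "nat \<Rightarrow> nat \<Rightarrow> (nat \<Rightarrow> nat) set"
  where "weak_compositions M j =
    {i. (\<forall>p. p \<notin> {1..M} \<longrightarrow> i p = 0) \<and> (\<Sum>p\<in>{1..M}. i p) = j}"

lemma weak_compositions_0_left: "weak_compositions 0 j = (if j = 0 then {\<lambda>_. 0} else {})"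
  by (auto simp: weak_compositions_def fun_eq_iff)

lemma weak_compositions_0_right: "weak_compositions M 0 = {\<lambda>_. 0}"
  by (auto simp: weak_compositions_def fun_eq_iff) (metis atLeastAtMost_iff One_nat_def)

text \<open>Either the last slot is empty, and then only \<open>M\<close> slots remain, or one unit
  can be taken out of it. This is the Pascal recursion of the multiset numbers binom(M+j-1,
  j).\<close>

lemma weak_compositions_Suc:
  "weak_compositions (Suc M) (Suc j) =
    weak_compositions M (Suc j) \<union>
    (\<lambda>i. i(Suc M := Suc (i (Suc M)))) ` weak_compositions (Suc M) j"
  (is "?L = ?A \<union> ?u ` ?B")
proof (intro equalityI subsetI)
  fix i assume i: "i \<in> ?L"
  show "i \<in> ?A \<union> ?u ` ?B"
  proof (cases "i (Suc M)")
    case 0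
    then have "i \<in> ?A"
      using i by (auto simp: weak_compositions_def) (metis le_Suc_eq)
    then show ?thesis by simp
  next
    case (Suc q)
    have "(\<Sum>p\<in>{1..M}. (i(Suc M := q)) p) = (\<Sum>p\<in>{1..M}. i p)"
      by (rule sum.cong) auto
    then have "i(Suc M := q) \<in> ?B"
      using i Suc by (auto simp: weak_compositions_def)
    moreover have "i = ?u (i(Suc M := q))"
      using Suc by auto
    ultimately show ?thesis by blast
  qed
next
  fix i assume "i \<in> ?A \<union> ?u ` ?B"
  then show "i \<in> ?L"
  proof
    assume "i \<in> ?u ` ?B"
    then obtain i' where i': "i' \<in> ?B" "i = ?u i'" by blast
    have "(\<Sum>p\<in>{1..M}. i p) = (\<Sum>p\<in>{1..M}. i' p)"
      unfolding i' by (rule sum.cong) auto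
    then show ?thesis
      using i' by (auto simp: weak_compositions_def)
  qed (auto simp: weak_compositions_def)
qed

lemma finite_weak_compositions: "finite (weak_compositions M j)"
proof (induction M arbitrary: j)
  case 0
  show ?case by (simp add: weak_compositions_0_left)
next
  case (Suc M)
  show ?case
    by (induction j) (simp_all add: weak_compositions_0_right weak_compositions_Suc Suc.IH)
qed

lemma card_weak_compositions_Suc:
  "card (weak_compositions (Suc M) (Suc j)) =
    card (weak_compositions M (Suc j)) + card (weak_compositions (Suc M) j)"
proof -
  let ?u = "\<lambda>i::nat \<Rightarrow> nat. i(Suc M := Suc (i (Suc M)))"
  have "inj ?u"
  proof (rule injI)
    fix i i' assume eq: "?u i = ?u i'"
    show "i = i'"
    proof
      fix p show "i p = i' p"
        using fun_cong[OF eq, of p] by (cases "p = Suc M") auto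
    qed
  qed
  moreover have "weak_compositions M (Suc j) \<inter> ?u ` weak_compositions (Suc M) j = {}"
    by (auto simp: weak_compositions_def)
  ultimately show ?thesis
    by (simp add: weak_compositions_Suc card_Un_disjoint finite_weak_compositions card_image
        inj_on_subset)
qed

text \<open>The coefficient of x^j in (1 + l x)^(-M): it counts the placements of \<open>j\<close>
  letters -l in \<open>M\<close> slots, each with the product of these letters.\<close>

definition insertion_weight :: "real \<Rightarrow> nat \<Rightarrow> nat \<Rightarrow> real"
  where "insertion_weight l j M = real (card (weak_compositions M j)) * (- l) ^ j"

text \<open>The third equation compares coefficients in (1 + l x) (1 + l x)^(-M-1) = (1 + l
  x)^(-M).\<close>

lemma insertion_weight_simps:
  "insertion_weight l 0 M = 1"
  "insertion_weight l (Suc j) 0 = 0"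
  "insertion_weight l (Suc j) (Suc M) = insertion_weight l (Suc j) M - l * insertion_weight l j (Suc M)"
  by (simp_all add: insertion_weight_def weak_compositions_0_right weak_compositions_0_left
      card_weak_compositions_Suc algebra_simps)

section \<open>Encoding of shuffles by sets of positions\<close>

definition k_subsets :: "nat \<Rightarrow> nat \<Rightarrow> nat set set"
  where "k_subsets N m = {A. A \<subseteq> {1..N} \<and> card A = m}"

text \<open>
  A shuffle is encoded by the set \<open>A\<close> of positions of the letters of its first word; \<open>first_end\<close> is
  the position at which one of the two words is exhausted.  Inserting \<open>0\<close> makes it \<open>0\<close> if one of the
  words is empty, so that no insertion is then possible.
\<close>

definition first_end :: "nat \<Rightarrow> nat set \<Rightarrow> nat"
  where "first_end N A = min (Max (insert 0 A)) (Max (insert 0 ({1..N} - A)))"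

lemma finite_k_subsets: "finite (k_subsets N m)"
  by (simp add: k_subsets_def)

text \<open>Position 1 is split off, not the last one, because the recursion of the product removes
  the first factor; the remaining positions move down by one.\<close>

lemma k_subsets_Suc:
  "k_subsets (Suc N) (Suc m) =
    image Suc ` k_subsets N (Suc m) \<union> (\<lambda>A. insert 1 (Suc ` A)) ` k_subsets N m"
  (is "?L = ?R")
proof (intro equalityI subsetI)
  fix A assume A: "A \<in> ?L"
  \<comment> \<open>The clause \<open>a \<noteq> 0\<close> discards the value 0 that arises from
    position 1.\<close>
  define B where "B = {a. Suc a \<in> A \<and> a \<noteq> 0}"
  have fin: "finite A"
    using A finite_subset by (auto simp: k_subsets_def)
  have sB: "B \<subseteq> {1..N}"
    using A by (auto simp: k_subsets_def B_def)
  have AB: "A - {1} = Suc ` B"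
  proof (intro equalityI subsetI)
    fix a assume "a \<in> A - {1}"
    moreover from this have "a \<noteq> 0" using A by (auto simp: k_subsets_def)
    ultimately have "a = Suc (a - 1)" "a - 1 \<in> B" by (auto simp: B_def)
    then show "a \<in> Suc ` B" by (rule image_eqI)
  qed (auto simp: B_def)
  have cB: "card B = card (A - {1})"
    unfolding AB by (simp add: card_image)
  show "A \<in> ?R"
  proof (cases "1 \<in> A")
    case True
    then have "B \<in> k_subsets N m"
      using A sB cB fin by (simp add: k_subsets_def)
    moreover have "A = insert 1 (Suc ` B)" using True AB by blast
    ultimately show ?thesis by blast
  next
    case False
    then have "B \<in> k_subsets N (Suc m)" "A = Suc ` B"
      using A sB cB AB by (simp_all add: k_subsets_def)
    then show ?thesis by blast
  qed
next
  have [simp]: "finite A" if "A \<subseteq> {Suc 0..N}" for A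
    using that finite_subset by blast
  fix A assume "A \<in> ?R"
  then show "A \<in> ?L"
    by (fastforce simp: k_subsets_def card_image card_insert_if)
qed

text \<open>The inserted 0 is not shifted, so \<open>A\<close> must be nonempty; in the next lemma 1
  is the shift of that 0, which also covers the empty set.\<close>

lemma Max_insert_0_image_Suc:
  "finite A \<Longrightarrow> A \<noteq> {} \<Longrightarrow> Max (insert 0 (Suc ` A)) = Suc (Max (insert 0 A))"
  by (simp add: mono_Max_commute[OF mono_Suc, symmetric])

lemma Max_insert_01_image_Suc:
  "finite A \<Longrightarrow> Max (insert 0 (insert 1 (Suc ` A))) = Suc (Max (insert 0 A))"
  by (cases "A = {}") (simp_all add: mono_Max_commute[OF mono_Suc, symmetric])

text \<open>Position 1 goes to one of the words. The other word must be nonempty, because the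
  maximum 0 that stands for an empty word does not move under the shift.\<close>

lemma first_end_Suc:
  assumes "A \<subseteq> {1..N}"
  shows "A \<noteq> {} \<Longrightarrow> first_end (Suc N) (Suc ` A) = Suc (first_end N A)"
    and "A \<noteq> {1..N} \<Longrightarrow> first_end (Suc N) (insert 1 (Suc ` A)) = Suc (first_end N A)"
proof -
  have fin: "finite A" using assms finite_subset by blast
  have iv: "{1..Suc N} = insert 1 (Suc ` {1..N})"
    using image_Suc_atLeastAtMost[of 1 N] by auto
  have c1: "{1..Suc N} - Suc ` A = insert 1 (Suc ` ({1..N} - A))"
    using assms unfolding iv image_set_diff[OF inj_Suc] by force
  have c2: "{1..Suc N} - insert 1 (Suc ` A) = Suc ` ({1..N} - A)"
    unfolding iv image_set_diff[OF inj_Suc] by force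
  show "first_end (Suc N) (Suc ` A) = Suc (first_end N A)" if "A \<noteq> {}"
    unfolding first_end_def c1
    by (subst Max_insert_0_image_Suc[OF fin that], subst Max_insert_01_image_Suc) simp_all
  show "first_end (Suc N) (insert 1 (Suc ` A)) = Suc (first_end N A)" if "A \<noteq> {1..N}"
    unfolding first_end_def c2
    by (subst Max_insert_0_image_Suc, simp, use assms that in blast,
        subst Max_insert_01_image_Suc[OF fin]) simp
qed

text \<open>The weight \<open>g\<close> stays arbitrary so that removing the first position can be
  expressed by passing to its shift.\<close>

definition subset_sum :: "nat \<Rightarrow> nat \<Rightarrow> (nat \<Rightarrow> real) \<Rightarrow> real"
  where "subset_sum m n g = (\<Sum>A\<in>k_subsets (m + n) m. g (first_end (m + n) A))"

lemma subset_sum_0_left: "subset_sum 0 n g = g 0"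
proof -
  have "k_subsets n 0 = {{}}"
    using finite_subset by (fastforce simp: k_subsets_def)
  then show ?thesis by (simp add: subset_sum_def first_end_def)
qed

lemma subset_sum_0_right: "subset_sum m 0 g = g 0"
proof -
  have "k_subsets m m = {{1..m}}"
    by (auto simp: k_subsets_def dest: card_subset_eq[rotated])
  then show ?thesis by (simp add: subset_sum_def first_end_def)
qed

text \<open>Position 1 belongs to the first or to the second word. Both are nonempty, so the word
  that keeps all its letters is nonempty and \<open>first_end\<close> drops by exactly one.\<close>

lemma subset_sum_Suc:
  "subset_sum (Suc m) (Suc n) g =
    subset_sum m (Suc n) (\<lambda>M. g (Suc M)) + subset_sum (Suc m) n (\<lambda>M. g (Suc M))"
proof -
  let ?N = "Suc (m + n)" and ?i = "\<lambda>A. insert 1 (Suc ` A)"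
  let ?g = "\<lambda>A. g (first_end (Suc ?N) A)"
  have inj: "inj_on (image Suc) (k_subsets ?N (Suc m))"
    by (intro inj_onI) (metis inj_image_eq_iff inj_Suc)
  have 0: "0 \<notin> A" if "A \<in> k_subsets ?N m" for A
    using that by (auto simp: k_subsets_def)
  have inj': "inj_on ?i (k_subsets ?N m)"
  proof (rule inj_onI)
    fix A B assume A: "A \<in> k_subsets ?N m" and B: "B \<in> k_subsets ?N m" and "?i A = ?i B"
    moreover have "1 \<notin> Suc ` A" "1 \<notin> Suc ` B" using 0[OF A] 0[OF B] by auto
    ultimately have "Suc ` A = Suc ` B" by (metis insert_ident)
    then show "A = B" by (metis inj_image_eq_iff inj_Suc)
  qed
  have disj: "image Suc ` k_subsets ?N (Suc m) \<inter> ?i ` k_subsets ?N m = {}"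
  proof -
    have "1 \<notin> Suc ` A" if "A \<in> k_subsets ?N (Suc m)" for A
      using that by (auto simp: k_subsets_def)
    then show ?thesis by blast
  qed
  \<comment> \<open>The second word still has n + 1 letters, so \<open>A\<close> cannot occupy all
    positions, as \<open>first_end_Suc\<close> demands.\<close>
  have card: "A \<noteq> {1..?N}" if "card A = m" for A
  proof
    assume "A = {1..?N}"
    then have "card A = ?N" by simp
    then show False using that by simp
  qed
  have "subset_sum (Suc m) (Suc n) g = (\<Sum>A\<in>k_subsets (Suc ?N) (Suc m). ?g A)"
    by (simp add: subset_sum_def)
  also have "\<dots> = (\<Sum>A\<in>k_subsets ?N (Suc m). ?g (Suc ` A)) + (\<Sum>A\<in>k_subsets ?N m. ?g (?i A))"
    unfolding k_subsets_Suc[of ?N]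
    using sum.union_disjoint[OF _ _ disj, of ?g] sum.reindex[OF inj, of ?g] sum.reindex[OF inj', of ?g]
    by (simp only: finite_k_subsets finite_imageI comp_def)
  also have "(\<Sum>A\<in>k_subsets ?N (Suc m). ?g (Suc ` A)) =
      (\<Sum>A\<in>k_subsets ?N (Suc m). g (Suc (first_end ?N A)))"
    by (intro sum.cong refl arg_cong[where f = g] first_end_Suc) (auto simp: k_subsets_def)
  also have "(\<Sum>A\<in>k_subsets ?N m. ?g (?i A)) =
      (\<Sum>A\<in>k_subsets ?N m. g (Suc (first_end ?N A)))"
    by (intro sum.cong refl arg_cong[where f = g] first_end_Suc) (use card in \<open>auto simp: k_subsets_def\<close>)
  finally show ?thesis by (simp add: subset_sum_def)
qed

section \<open>From shuffle permutations to sets of positions\<close>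

text \<open>Each function enumerates the same finite set in increasing order, and such an
  enumeration is unique.\<close>

lemma strict_mono_on_eq_if_image_eq:
  fixes f g :: "nat \<Rightarrow> nat"
  assumes "strict_mono_on {a..b} f" "strict_mono_on {a..b} g" "f ` {a..b} = g ` {a..b}"
    and "x \<in> {a..b}"
  shows "f x = g x"
proof -
  have "sorted_wrt (<) (map h [a..<Suc b])" if "strict_mono_on {a..b} h" for h :: "nat \<Rightarrow> nat"
    unfolding sorted_wrt_map
    by (rule sorted_wrt_mono_rel[OF _ sorted_wrt_upt]) (use that in \<open>auto simp: strict_mono_on_def\<close>)
  moreover have "set [a..<Suc b] = {a..b}" by auto
  ultimately have "map f [a..<Suc b] = map g [a..<Suc b]"
    using assms by (intro strict_sorted_equal) (simp_all only: set_map)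
  then show ?thesis
    using assms(4) \<open>set [a..<Suc b] = {a..b}\<close> by (auto simp: map_eq_conv simp del: upt_Suc)
qed

lemma shuffle_perms_image_compl:
  fixes m n :: nat
  assumes "\<sigma> permutes {1..m + n}"
  shows "inv_into UNIV \<sigma> ` {m + 1..m + n} = {1..m + n} - inv_into UNIV \<sigma> ` {1..m}"
proof -
  have p: "inv_into UNIV \<sigma> permutes {1..m + n}" by (rule permutes_inv[OF assms])
  have "{m + 1..m + n} = {1..m + n} - {1..m}" by auto
  then show ?thesis
    by (simp only: image_set_diff[OF permutes_inj[OF p]] permutes_image[OF p])
qed

text \<open>The inverse permutation sends letters to positions. It increases on both blocks, hence
  is determined by the positions of the first block; conversely, listing \<open>A\<close> and then
  its complement in increasing order produces such a permutation.\<close>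

lemma bij_betw_shuffle_perms_k_subsets:
  "bij_betw (\<lambda>\<sigma>. inv_into UNIV \<sigma> ` {1..m}) (shuffle_perms m n) (k_subsets (m + n) m)"
  (is "bij_betw ?F _ _")
proof (intro bij_betw_imageI inj_onI equalityI subsetI)
  fix \<sigma> \<tau> assume s: "\<sigma> \<in> shuffle_perms m n" and t: "\<tau> \<in> shuffle_perms m n" and eq: "?F \<sigma> = ?F \<tau>"
  have ps: "\<sigma> permutes {1..m + n}" and pt: "\<tau> permutes {1..m + n}"
    using s t by (auto simp: shuffle_perms_def)
  have "inv_into UNIV \<sigma> x = inv_into UNIV \<tau> x" for x
  proof -
    consider "x \<in> {1..m}" | "x \<in> {m + 1..m + n}" | "x \<notin> {1..m + n}" by fastforce
    then show ?thesis
    proof cases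
      case 1
      then show ?thesis
        by (intro strict_mono_on_eq_if_image_eq[OF _ _ eq]) (use s t in \<open>auto simp: shuffle_perms_def\<close>)
    next
      case 2
      moreover have "inv_into UNIV \<sigma> ` {m + 1..m + n} = inv_into UNIV \<tau> ` {m + 1..m + n}"
        by (simp only: shuffle_perms_image_compl[OF ps] shuffle_perms_image_compl[OF pt] eq)
      ultimately show ?thesis
        by (intro strict_mono_on_eq_if_image_eq[of "m + 1" "m + n"])
          (use s t in \<open>auto simp: shuffle_perms_def\<close>)
    next
      case 3
      then show ?thesis
        using permutes_not_in[OF permutes_inv[OF ps]] permutes_not_in[OF permutes_inv[OF pt]] by simp
    qed
  qed
  then have "inv_into UNIV \<sigma> = inv_into UNIV \<tau>" by (rule ext)
  then show "\<sigma> = \<tau>"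
    using permutes_inv_inv[OF ps] permutes_inv_inv[OF pt] by metis
next
  fix A assume "A \<in> ?F ` shuffle_perms m n"
  then obtain \<sigma> where s: "\<sigma> \<in> shuffle_perms m n" and A: "A = ?F \<sigma>" by blast
  have p: "inv_into UNIV \<sigma> permutes {1..m + n}"
    using s by (auto simp: shuffle_perms_def intro: permutes_inv)
  have "A \<subseteq> inv_into UNIV \<sigma> ` {1..m + n}" unfolding A by (rule image_mono) auto
  then have "A \<subseteq> {1..m + n}" by (simp only: permutes_image[OF p])
  moreover have "card A = m"
    unfolding A by (simp add: card_image inj_on_subset[OF permutes_inj[OF p]])
  ultimately show "A \<in> k_subsets (m + n) m"
    by (simp add: k_subsets_def)
next
  fix A assume A: "A \<in> k_subsets (m + n) m"
  let ?N = "m + n"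
  let ?B = "{1..?N} - A"
  have finA: "finite A" and subA: "A \<subseteq> {1..?N}" and cardA: "card A = m"
    using A finite_subset by (auto simp: k_subsets_def)
  have cardB: "card ?B = n"
    using card_Diff_subset[OF finA subA] cardA by simp
  define xs where "xs = sorted_list_of_set A"
  define ys where "ys = sorted_list_of_set ?B"
  have lx: "length xs = m" and ly: "length ys = n"
    by (simp_all add: xs_def ys_def cardA cardB[simplified])
  have sx: "set xs = A" and sy: "set ys = ?B"
    using finA by (simp_all add: xs_def ys_def)
  have wx: "sorted_wrt (<) xs" and wy: "sorted_wrt (<) ys"
    by (simp_all add: xs_def ys_def)
  \<comment> \<open>This is the inverse of the desired shuffle. Letters and positions count from 1,
    list entries from 0.\<close>
  define \<pi> where "\<pi> j = (if j \<in> {1..?N} then (xs @ ys) ! (j - 1) else j)" for j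
  have "bij_betw (nth (xs @ ys)) {..<?N} {1..?N}"
    by (rule bij_betw_nth) (use finA subA in \<open>auto simp: xs_def ys_def cardA cardB[simplified]\<close>)
  moreover have "bij_betw (\<lambda>j. j - 1) {1..?N} {..<?N}"
    by (rule bij_betw_byWitness[where f' = Suc]) auto
  ultimately have "bij_betw (nth (xs @ ys) \<circ> (\<lambda>j. j - 1)) {1..?N} {1..?N}"
    by (rule bij_betw_trans[rotated])
  then have "bij_betw \<pi> {1..?N} {1..?N}"
    by (rule bij_betw_cong[THEN iffD1, rotated]) (simp add: \<pi>_def)
  then have perm: "\<pi> permutes {1..?N}"
    by (rule bij_imp_permutes) (simp only: \<pi>_def if_False)
  have \<pi>1: "\<pi> j = xs ! (j - 1)" if "j \<in> {1..m}" for j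
    using that lx by (auto simp: \<pi>_def nth_append)
  have \<pi>2: "\<pi> j = ys ! (j - 1 - m)" if "j \<in> {m + 1..m + n}" for j
    using that lx by (auto simp: \<pi>_def nth_append)
  have "strict_mono_on {1..m} \<pi>"
    by (intro strict_mono_onI)
      (use lx sorted_wrt_nth_less[OF wx] in \<open>simp add: \<pi>1\<close>)
  moreover have "strict_mono_on {m + 1..m + n} \<pi>"
    by (intro strict_mono_onI)
      (use ly in \<open>auto simp: \<pi>2[simplified] intro!: sorted_wrt_nth_less[OF wy]\<close>)
  ultimately have "inv_into UNIV \<pi> \<in> shuffle_perms m n"
    using perm by (simp add: shuffle_perms_def permutes_inv permutes_inv_inv)
  moreover have "A = inv_into UNIV (inv_into UNIV \<pi>) ` {1..m}"
  proof -
    have "\<pi> ` {1..m} = nth xs ` (\<lambda>j. j - 1) ` {1..m}"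
      unfolding image_image by (rule image_cong) (simp_all add: \<pi>1)
    also have "(\<lambda>j. j - 1) ` {1..m} = {0..<length xs}"
      using lx image_minus_const_atLeastLessThan_nat[of 1 1 "m + 1"] by (simp add: atLeastLessThanSuc_atLeastAtMost)
    also have "nth xs ` {0..<length xs} = A" by (simp add: nth_image sx[symmetric] flip: atLeast0LessThan)
    finally show ?thesis by (simp add: permutes_inv_inv[OF perm])
  qed
  ultimately show "A \<in> ?F ` shuffle_perms m n" by blast
qed

text \<open>Positions increase along a block, so the maximum is attained at its last letter. Thus
  \<open>first_end\<close> is the bound in \<open>insertion_indices\<close>.\<close>

lemma first_end_shuffle_perm:
  assumes "\<sigma> \<in> shuffle_perms m n" "m > 0" "n > 0"
  shows "first_end (m + n) (inv_into UNIV \<sigma> ` {1..m}) = min (inv_into UNIV \<sigma> m) (inv_into UNIV \<sigma> (m + n))"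
proof -
  have Max: "Max (insert 0 (f ` {a..b})) = f b"
    if "strict_mono_on {a..b} f" "a \<le> b" for f :: "nat \<Rightarrow> nat" and a b
    by (intro Max_eqI) (use that in \<open>auto intro: strict_mono_on_leD[of "{a..b}"]\<close>)
  have \<sigma>: "\<sigma> permutes {1..m + n}" "strict_mono_on {1..m} (inv_into UNIV \<sigma>)"
    "strict_mono_on {m + 1..m + n} (inv_into UNIV \<sigma>)"
    using assms by (simp_all add: shuffle_perms_def)
  have "Max (insert 0 (inv_into UNIV \<sigma> ` {1..m})) = inv_into UNIV \<sigma> m"
    "Max (insert 0 (inv_into UNIV \<sigma> ` {m + 1..m + n})) = inv_into UNIV \<sigma> (m + n)"
    by (rule Max[OF \<sigma>(2)], use assms in simp) (rule Max[OF \<sigma>(3)], use assms in simp)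
  then show ?thesis
    by (simp only: first_end_def shuffle_perms_image_compl[OF \<sigma>(1), symmetric])
qed

lemma length_shuffle_word:
  "length (shuffle_word l cs \<sigma> i) = length cs + (\<Sum>j\<in>{1..length cs}. i j)"
proof -
  have "length (shuffle_word l cs \<sigma> i) = (\<Sum>j\<leftarrow>[1..<length cs + 1]. i j + 1)"
    by (simp add: shuffle_word_def length_concat comp_def)
  also have "\<dots> = (\<Sum>j\<in>set [1..<length cs + 1]. i j + 1)"
    by (rule sum_list_distinct_conv_sum_set) simp
  also have "set [1..<length cs + 1] = {1..length cs}" by auto
  finally show ?thesis by (simp add: sum_Suc)
qed

lemma prod_list_shuffle_word_ones:
  assumes "\<sigma> permutes {1..N}"
  shows "prod_list (shuffle_word l (replicate N 1) \<sigma> i) = (- l) ^ (\<Sum>j\<in>{1..N}. i j)"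
proof -
  have concat: "prod_list (concat (map f js)) = prod_list (map (\<lambda>j. prod_list (f j)) js)"
    for f :: "nat \<Rightarrow> real list" and js
    by (induction js) simp_all
  have ones: "replicate N (1::real) ! (\<sigma> j - 1) = 1" if "j \<in> {1..N}" for j
    using that permutes_in_image[OF assms, of j] by auto
  have "prod_list (shuffle_word l (replicate N 1) \<sigma> i) =
      prod_list (map (\<lambda>j. (- l) ^ i j * replicate N 1 ! (\<sigma> j - 1)) [1..<N + 1])"
    by (simp add: shuffle_word_def concat prod_list_replicate)
  also have "\<dots> = (\<Prod>j\<in>set [1..<N + 1]. (- l) ^ i j * replicate N 1 ! (\<sigma> j - 1))"
    by (rule prod.distinct_set_conv_list[symmetric]) simp
  also have "set [1..<N + 1] = {1..N}" by auto
  also have "(\<Prod>j\<in>{1..N}. (- l) ^ i j * replicate N 1 ! (\<sigma> j - 1)) = (\<Prod>j\<in>{1..N}. (- l) ^ i j)"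
    by (rule prod.cong) (use ones in simp_all)
  finally show ?thesis by (simp add: power_sum)
qed

section \<open>The recursion of the structure constants\<close>

text \<open>The structure constants of the modified shuffle product in the bases formed by the
  tensors of ones.\<close>

definition shuffle_coeff :: "real \<Rightarrow> nat \<Rightarrow> nat \<Rightarrow> nat \<Rightarrow> real"
  where "shuffle_coeff l m n k = mod_shuffle l (replicate m 1) (replicate n 1) k"

text \<open>The bound is at most m + n, so the two vanishing conditions of
  \<open>insertion_indices\<close> merge into one, and the sum over all positions stops at the
  bound.\<close>

lemma insertion_indices_weak_compositions:
  assumes "\<sigma> \<in> shuffle_perms m n" "m > 0" "n > 0"
  shows "{i \<in> insertion_indices m n \<sigma>. (\<Sum>j\<in>{1..m + n}. i j) = q} =
    weak_compositions (first_end (m + n) (inv_into UNIV \<sigma> ` {1..m})) q"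
proof -
  let ?M = "min (inv_into UNIV \<sigma> m) (inv_into UNIV \<sigma> (m + n))"
  have "inv_into UNIV \<sigma> permutes {1..m + n}"
    using assms by (auto simp: shuffle_perms_def intro: permutes_inv)
  then have "inv_into UNIV \<sigma> m \<in> {1..m + n}"
    by (subst permutes_in_image) (use assms in auto)
  then have M: "?M \<le> m + n" by auto
  have supp: "i \<in> insertion_indices m n \<sigma> \<longleftrightarrow> (\<forall>p. p \<notin> {1..?M} \<longrightarrow> i p = 0)" for i
  proof -
    have "p \<notin> {1..?M} \<longleftrightarrow> p \<notin> {1..m + n} \<or> p \<in> {1..m + n} \<and> p > ?M" for p
      using M by (simp only: atLeastAtMost_iff) linarith
    then show ?thesis
      unfolding insertion_indices_def mem_Collect_eq by blast
  qed
  have "(\<Sum>j\<in>{1..m + n}. i j) = (\<Sum>j\<in>{1..?M}. i j)" if "\<forall>p. p \<notin> {1..?M} \<longrightarrow> i p = 0" for i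
    by (rule sum.mono_neutral_right) (use M that in auto)
  then show ?thesis
    unfolding first_end_shuffle_perm[OF assms] weak_compositions_def
    using supp by auto
qed

text \<open>The length fixes the number q of inserted letters, and on tensors of ones every word
  with q insertions contributes (-l)^q. A shuffle thus matters only through
  \<open>first_end\<close>, and position sets can replace shuffles.\<close>

lemma shuffle_coeff_eq:
  "shuffle_coeff l m n k =
    (if k < m + n then 0 else subset_sum m n (insertion_weight l (k - (m + n))))"
proof (cases "m = 0 \<or> n = 0")
  case True
  \<comment> \<open>An empty word leaves no slot: the weight is 1 without insertions and 0
    otherwise, in agreement with the separate clauses of \<open>mod_shuffle\<close>.\<close>
  have "insertion_weight l q 0 = (if q = 0 then 1 else 0)" for q
    by (cases q) (simp_all add: insertion_weight_simps)
  then show ?thesis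
    using True by (auto simp: shuffle_coeff_def mod_shuffle_def ptensor_def prod_list_replicate
        subset_sum_0_left subset_sum_0_right)
next
  case False
  let ?word = "\<lambda>\<sigma> i. shuffle_word l (replicate (m + n) 1) \<sigma> i"
  let ?I = "\<lambda>\<sigma>. {i \<in> insertion_indices m n \<sigma>. length (?word \<sigma> i) = k}"
  have *: "(\<Sum>i\<in>?I \<sigma>. ptensor (?word \<sigma> i) k) =
      (if k < m + n then 0
       else insertion_weight l (k - (m + n)) (first_end (m + n) (inv_into UNIV \<sigma> ` {1..m})))"
    if \<sigma>: "\<sigma> \<in> shuffle_perms m n" for \<sigma>
  proof (cases "k < m + n")
    case True
    then have I: "?I \<sigma> = {}" by (auto simp: length_shuffle_word)
    show ?thesis unfolding I using True by simp
  next
    case False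
    let ?q = "k - (m + n)"
    have perm: "\<sigma> permutes {1..m + n}" using \<sigma> by (simp add: shuffle_perms_def)
    have "?I \<sigma> = {i \<in> insertion_indices m n \<sigma>. (\<Sum>j\<in>{1..m + n}. i j) = ?q}"
      using False by (auto simp: length_shuffle_word)
    also have "\<dots> = weak_compositions (first_end (m + n) (inv_into UNIV \<sigma> ` {1..m})) ?q"
      using \<sigma> \<open>\<not> (m = 0 \<or> n = 0)\<close> by (intro insertion_indices_weak_compositions) auto
    finally have I: "?I \<sigma> = weak_compositions (first_end (m + n) (inv_into UNIV \<sigma> ` {1..m})) ?q" .
    have "ptensor (?word \<sigma> i) k = (- l) ^ ?q" if "i \<in> ?I \<sigma>" for i
    proof -
      have "k = m + n + (\<Sum>j\<in>{1..m + n}. i j)"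
        using that by (simp add: length_shuffle_word)
      then show ?thesis
        using that by (simp add: ptensor_def prod_list_shuffle_word_ones[OF perm])
    qed
    then have "(\<Sum>i\<in>?I \<sigma>. ptensor (?word \<sigma> i) k) = (\<Sum>i\<in>?I \<sigma>. (- l) ^ ?q)"
      by (rule sum.cong[OF refl])
    then show ?thesis
      using False by (simp only: I sum_constant insertion_weight_def if_False)
  qed
  have "shuffle_coeff l m n k = (\<Sum>\<sigma>\<in>shuffle_perms m n. \<Sum>i\<in>?I \<sigma>. ptensor (?word \<sigma> i) k)"
    using False by (simp add: shuffle_coeff_def mod_shuffle_def replicate_add)
  also have "\<dots> = (\<Sum>\<sigma>\<in>shuffle_perms m n. if k < m + n then 0
       else insertion_weight l (k - (m + n)) (first_end (m + n) (inv_into UNIV \<sigma> ` {1..m})))"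
    by (rule sum.cong[OF refl *])
  also have "\<dots> = (\<Sum>A\<in>k_subsets (m + n) m. if k < m + n then 0
       else insertion_weight l (k - (m + n)) (first_end (m + n) A))"
    by (rule sum.reindex_bij_betw[OF bij_betw_shuffle_perms_k_subsets])
  finally show ?thesis by (simp add: subset_sum_def)
qed

lemma shuffle_coeff_simps:
  "shuffle_coeff l 0 n k = (if k = n then 1 else 0)"
  "shuffle_coeff l m 0 k = (if k = m then 1 else 0)"
  by (auto simp: shuffle_coeff_def mod_shuffle_def ptensor_def prod_list_replicate)

lemma shuffle_coeff_eq_0: "k < m + n \<Longrightarrow> shuffle_coeff l m n k = 0"
  by (simp add: shuffle_coeff_eq)

text \<open>The first factor is the first letter of either word, or an inserted -l, which leaves
  both words unchanged.\<close>

lemma shuffle_coeff_Suc: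
  "shuffle_coeff l (Suc m) (Suc n) (Suc k) =
    shuffle_coeff l m (Suc n) k + shuffle_coeff l (Suc m) n k - l * shuffle_coeff l (Suc m) (Suc n) k"
proof -
  \<comment> \<open>The cases are: too few factors, no insertion, and q + 1 insertions.\<close>
  consider "k < m + n + 1" | "k = m + n + 1" | q where "k = m + n + 2 + q"
    using less_iff_Suc_add[of "m + n + 1" k] by fastforce
  then show ?thesis
  proof cases
    case 3
    then have q: "k - (m + Suc n) = Suc q" "k - (Suc m + n) = Suc q" "Suc k - (Suc m + Suc n) = Suc q"
      "k - (Suc m + Suc n) = q" by simp_all
    \<comment> \<open>Splitting off position 1 shifts the weight by one slot; the weight recursion
      then produces terms with factor l, which reassemble into the sum for q insertions.\<close>
    have "subset_sum (Suc m) (Suc n) (insertion_weight l (Suc q)) =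
        subset_sum m (Suc n) (insertion_weight l (Suc q)) + subset_sum (Suc m) n (insertion_weight l (Suc q))
        - l * subset_sum (Suc m) (Suc n) (insertion_weight l q)"
      unfolding subset_sum_Suc
      by (simp add: insertion_weight_simps subset_sum_def sum_subtractf sum_distrib_left algebra_simps)
    then show ?thesis
      using 3 unfolding shuffle_coeff_eq q by simp
  next
    case 2
    then show ?thesis
      by (simp add: shuffle_coeff_eq subset_sum_Suc insertion_weight_simps)
        (simp add: subset_sum_def insertion_weight_simps)
  qed (simp add: shuffle_coeff_eq)
qed

section \<open>Complete filtrations\<close>

text \<open>Only the additive group enters, so the same facts serve for R and for
  \<open>structure_module R\<close>, which differ in their scalars.\<close>

locale filtered_group = abelian_group G for G :: "('c, 'a, 'm) module_scheme" (structure) +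
  fixes F :: "nat \<Rightarrow> 'a set"
  assumes filt_subgroup: "subgroup (F n) (add_monoid G)"
    and filt_decseq: "decseq F"
begin

definition separated :: bool
  where "separated \<longleftrightarrow> (\<forall>x\<in>carrier G. (\<forall>n. x \<in> F n) \<longrightarrow> x = \<zero>)"

text \<open>Sequences with this rate are exactly the systems of representatives of elements of the
  inverse limit.\<close>

definition cauchy_complete :: bool
  where "cauchy_complete \<longleftrightarrow>
    (\<forall>X. (\<forall>n. X n \<in> carrier G) \<and> (\<forall>n. X (Suc n) \<ominus> X n \<in> F n) \<longrightarrow>
      (\<exists>x\<in>carrier G. \<forall>n. x \<ominus> X n \<in> F n))"

lemma filt_additive_subgroup: "additive_subgroup (F n) G"
  by (rule additive_subgroupI[OF filt_subgroup])

lemma filt_abelian_subgroup: "abelian_subgroup (F n) G"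
  by (intro abelian_subgroupI3 filt_additive_subgroup) unfold_locales

lemma filt_carrier: "x \<in> F n \<Longrightarrow> x \<in> carrier G"
  by (rule additive_subgroup.a_Hcarr[OF filt_additive_subgroup])

lemma filt_zero [simp]: "\<zero> \<in> F n"
  by (rule additive_subgroup.zero_closed[OF filt_additive_subgroup])

lemma filt_add [intro]: "x \<in> F n \<Longrightarrow> y \<in> F n \<Longrightarrow> x \<oplus> y \<in> F n"
  by (rule additive_subgroup.a_closed[OF filt_additive_subgroup])

lemma filt_a_inv: "x \<in> F n \<Longrightarrow> \<ominus> x \<in> F n"
  using subgroup.m_inv_closed[OF filt_subgroup] by (simp add: a_inv_def)

lemma filt_minus: "x \<in> F n \<Longrightarrow> y \<in> F n \<Longrightarrow> x \<ominus> y \<in> F n"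
  by (simp add: a_minus_def filt_add filt_a_inv)

lemma filt_mono: "m \<le> n \<Longrightarrow> x \<in> F n \<Longrightarrow> x \<in> F m"
  using filt_decseq by (auto simp: decseq_def)

lemma diff_add_diff:
  "x \<in> carrier G \<Longrightarrow> y \<in> carrier G \<Longrightarrow> z \<in> carrier G \<Longrightarrow> (x \<ominus> y) \<oplus> (y \<ominus> z) = x \<ominus> z"
  by (simp add: a_minus_def a_assoc r_neg1)

lemma filt_diff_trans:
  "\<lbrakk>x \<ominus> y \<in> F n; y \<ominus> z \<in> F n; x \<in> carrier G; y \<in> carrier G; z \<in> carrier G\<rbrakk> \<Longrightarrow> x \<ominus> z \<in> F n"
  using filt_add[of "x \<ominus> y" n "y \<ominus> z"] by (simp add: diff_add_diff)

lemma filt_diff_commute: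
  "\<lbrakk>x \<ominus> y \<in> F n; x \<in> carrier G; y \<in> carrier G\<rbrakk> \<Longrightarrow> y \<ominus> x \<in> F n"
  using filt_a_inv[of "x \<ominus> y" n] by (simp add: a_minus_def minus_add minus_minus a_comm)

lemma diff_zero_imp_eq:
  "\<lbrakk>x \<ominus> y = \<zero>; x \<in> carrier G; y \<in> carrier G\<rbrakk> \<Longrightarrow> x = y"
  by (metis a_minus_def minus_equality minus_minus a_inv_closed)

lemma mem_coset_iff:
  assumes "x \<in> carrier G" "y \<in> carrier G"
  shows "y \<in> F n +> x \<longleftrightarrow> y \<ominus> x \<in> F n"
  using abelian_subgroup.a_rcos_module[OF filt_abelian_subgroup assms] by (simp add: a_minus_def)

lemma coset_carrier: "x \<in> carrier G \<Longrightarrow> y \<in> F n +> x \<Longrightarrow> y \<in> carrier G"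
  by (rule abelian_subgroup.a_elemrcos_carrier[OF filt_abelian_subgroup])

lemma coset_eq_iff:
  assumes "x \<in> carrier G" "y \<in> carrier G"
  shows "F n +> x = F n +> y \<longleftrightarrow> x \<ominus> y \<in> F n"
  using assms abelian_subgroup.a_rcos_self[OF filt_abelian_subgroup]
    abelian_subgroup.a_repr_independence'[OF filt_abelian_subgroup]
  by (metis mem_coset_iff)

lemma coset_mem_rcosets: "x \<in> carrier G \<Longrightarrow> F n +> x \<in> A_RCOSETS G (F n)"
  using a_rcosetsI filt_carrier by blast

text \<open>In terms of representatives, the transition maps of the inverse limit are the
  identity.\<close>

lemma filt_add_coset:
  assumes "m \<le> n" "x \<in> carrier G"
  shows "F m <+>\<^bsub>G\<^esub> (F n +> x) = F m +> x"
proof (intro equalityI subsetI)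
  fix z assume "z \<in> F m <+>\<^bsub>G\<^esub> (F n +> x)"
  then obtain u v w where z: "z = u \<oplus> (v \<oplus> x)" "u \<in> F m" "v \<in> F n"
    by (auto simp: set_add_def' a_r_coset_def')
  then have "z = (u \<oplus> v) \<oplus> x"
    using assms filt_carrier by (simp add: a_assoc)
  moreover have "u \<oplus> v \<in> F m" using z filt_mono[OF assms(1)] by auto
  ultimately show "z \<in> F m +> x" by (auto simp: a_r_coset_def')
next
  fix z assume "z \<in> F m +> x"
  then obtain u where z: "z = u \<oplus> x" "u \<in> F m" by (auto simp: a_r_coset_def')
  then have "z = u \<oplus> (\<zero> \<oplus> x)" using assms by simp
  then show "z \<in> F m <+>\<^bsub>G\<^esub> (F n +> x)"
    using z(2) filt_zero[of n] unfolding set_add_def' a_r_coset_def' by blast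
qed

lemma cauchy_diff:
  assumes X: "\<And>n. X n \<in> carrier G" "\<And>n. X (Suc n) \<ominus> X n \<in> F n" and "m \<le> n"
  shows "X n \<ominus> X m \<in> F m"
  using \<open>m \<le> n\<close>
proof (induction n rule: dec_induct)
  case base
  show ?case using X(1)[of m] by (simp add: a_minus_def r_neg)
next
  case (step n)
  then show ?case
    using filt_diff_trans[of "X (Suc n)" "X n" m "X m"] filt_mono[of m n] X by auto
qed

text \<open>Injectivity is separation. Surjectivity is convergence: representatives of a compatible
  family of cosets form a Cauchy sequence, whose limit represents every member.\<close>

lemma bij_betw_inverse_limit_iff:
  "bij_betw (\<lambda>x n. F n +> x) (carrier G) (inverse_limit G F) \<longleftrightarrow> separated \<and> cauchy_complete"
  (is "bij_betw ?c _ _ \<longleftrightarrow> _")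
proof (intro iffI conjI)
  assume bij: "bij_betw ?c (carrier G) (inverse_limit G F)"
  show separated
    unfolding separated_def
  proof (intro ballI impI)
    fix x assume x: "x \<in> carrier G" "\<forall>n. x \<in> F n"
    then have "?c x = ?c \<zero>"
      by (intro ext) (simp add: coset_eq_iff filt_minus)
    then show "x = \<zero>"
      using bij x(1) by (auto simp: bij_betw_def dest: inj_onD)
  qed
  show cauchy_complete
    unfolding cauchy_complete_def
  proof (intro allI impI, elim conjE)
    fix X assume X: "\<forall>n. X n \<in> carrier G" "\<forall>n. X (Suc n) \<ominus> X n \<in> F n"
    have "F m +> X m = F m <+>\<^bsub>G\<^esub> (F n +> X n)" if "m \<le> n" for m n
      using cauchy_diff[of X m n] X that filt_diff_commute
      by (simp add: filt_add_coset coset_eq_iff)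
    then have "(\<lambda>n. F n +> X n) \<in> inverse_limit G F"
      using X by (simp add: inverse_limit_def coset_mem_rcosets)
    then obtain x where "x \<in> carrier G" "(\<lambda>n. F n +> X n) = ?c x"
      using bij by (auto simp: bij_betw_def)
    then show "\<exists>x\<in>carrier G. \<forall>n. x \<ominus> X n \<in> F n"
      using X by (metis coset_eq_iff)
  qed
next
  assume "separated \<and> cauchy_complete"
  then have sep: separated and com: cauchy_complete by auto
  show "bij_betw ?c (carrier G) (inverse_limit G F)"
  proof (intro bij_betw_imageI inj_onI equalityI subsetI)
    fix x y assume xy: "x \<in> carrier G" "y \<in> carrier G" "?c x = ?c y"
    have "x \<ominus> y \<in> F n" for n
      using fun_cong[OF xy(3), of n] xy by (simp add: coset_eq_iff)
    then have "x \<ominus> y = \<zero>" using sep xy by (simp add: separated_def)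
    then show "x = y" by (rule diff_zero_imp_eq[OF _ xy(1,2)])
  next
    fix C assume "C \<in> ?c ` carrier G"
    then show "C \<in> inverse_limit G F"
      by (auto simp: inverse_limit_def coset_mem_rcosets filt_add_coset)
  next
    fix C assume "C \<in> inverse_limit G F"
    then have C: "\<And>n. C n \<in> A_RCOSETS G (F n)" "\<And>m n. m \<le> n \<Longrightarrow> C m = F m <+>\<^bsub>G\<^esub> C n"
      by (auto simp: inverse_limit_def)
    have "\<forall>n. \<exists>x\<in>carrier G. C n = F n +> x"
      using C(1) unfolding A_RCOSETS_def' by blast
    then obtain X where X: "\<And>n. X n \<in> carrier G" "\<And>n. C n = F n +> X n"
      by metis
    have "X (Suc n) \<ominus> X n \<in> F n" for n
      using C(2)[of n "Suc n"] filt_diff_commute X by (simp add: filt_add_coset coset_eq_iff)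
    then obtain x where x: "x \<in> carrier G" "\<And>n. x \<ominus> X n \<in> F n"
      using com X(1) unfolding cauchy_complete_def by blast
    have "C = ?c x"
      using x X filt_diff_commute by (intro ext) (simp add: coset_eq_iff)
    then show "C \<in> ?c ` carrier G" using x(1) by blast
  qed
qed

lemma topspace_filtration_topology: "topspace (filtration_topology G F) = carrier G"
proof -
  have "\<Union> {F n +> x | n x. x \<in> carrier G} = carrier G"
    using coset_carrier abelian_subgroup.a_rcos_self[OF filt_abelian_subgroup] by blast
  then show ?thesis by (simp add: filtration_topology_def)
qed

text \<open>An open subgroup is closed: the coset of x is a neighbourhood of x, and if it meets
  \<open>F n\<close> it equals \<open>F n\<close>.\<close>

lemma closure_of_filt: "filtration_topology G F closure_of F n = F n"
proof (intro equalityI subsetI)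
  fix x assume x: "x \<in> filtration_topology G F closure_of F n"
  then have xc: "x \<in> carrier G"
    by (simp add: in_closure_of topspace_filtration_topology)
  then have "openin (filtration_topology G F) (F n +> x)" "x \<in> F n +> x"
    by (auto simp: filtration_topology_def intro: topology_generated_by_Basis
        abelian_subgroup.a_rcos_self[OF filt_abelian_subgroup])
  then obtain y where y: "y \<in> F n" "y \<in> F n +> x"
    using x by (auto simp: in_closure_of)
  then have "y \<ominus> x \<in> F n" using xc filt_carrier mem_coset_iff by blast
  then have "y \<ominus> (y \<ominus> x) \<in> F n" using y filt_minus by blast
  moreover have "y \<ominus> (y \<ominus> x) = x"
    using xc filt_carrier[OF y(1)] by (simp add: a_minus_def minus_add minus_minus r_neg1 r_neg2)
  ultimately show "x \<in> F n" by simp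
next
  fix x assume "x \<in> F n"
  then show "x \<in> filtration_topology G F closure_of F n"
    using closure_of_subset[of "F n" "filtration_topology G F"] filt_carrier
    by (auto simp: topspace_filtration_topology)
qed

end

section \<open>Compatible filtrations in terms of P\<close>

lemma submodule_imp_subgroup: "submodule N A M \<Longrightarrow> subgroup N (add_monoid M)"
  by (rule submodule.axioms(1))

lemma generated_submodule_id: "submodule N A M \<Longrightarrow> generated_submodule A M N = N"
  by (auto simp: generated_submodule_def)

text \<open>Both concrete filtrations satisfy the sharp equation F(n+1) = P(F n). As F(n+1) is a
  closed submodule, generating and closing add nothing.\<close>

lemma compatible_complete_operated_moduleI:
  assumes op: "operated_module A M P"
    and sub: "\<And>n. submodule (F n) A M"
    and dec: "decseq F"
    and F_0: "F 0 = carrier M"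
    and F_Suc: "\<And>n. F (Suc n) = P ` F n"
    and sep: "filtered_group.separated M F"
    and com: "filtered_group.cauchy_complete M F"
  shows "compatible_complete_operated_module A M F P"
proof -
  have "abelian_group M"
    using op by (simp add: operated_module_def Module.module_def)
  then interpret filtered_group M F
    by (intro filtered_group.intro filtered_group_axioms.intro dec submodule_imp_subgroup[OF sub])
  have "P ` F n \<subseteq> F n" for n
    using F_Suc[of n] dec by (auto simp: decseq_Suc_iff)
  then have "operated_submodule A M P (F n)" for n
    using sub by (simp add: operated_submodule_def)
  moreover have "F n = closed_operator_filtration A M F P n" for n
  proof (induction n)
    case (Suc n)
    have "closed_operator_filtration A M F P (Suc n) =
        filtration_topology M F closure_of generated_submodule A M (F (Suc n))"
      by (simp add: F_Suc flip: Suc.IH)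
    then show ?case by (simp only: generated_submodule_id[OF sub] closure_of_filt)
  qed (simp add: F_0)
  ultimately show ?thesis
    unfolding compatible_complete_operated_module_def complete_operated_module_def
      bij_betw_inverse_limit_iff
    using op dec sep com by blast
qed

text \<open>The recursive definition of the filtration is condensed to the fact that P raises the
  filtration index by one, which drives all later inductions.\<close>

lemma compatible_complete_operated_moduleD:
  assumes "compatible_complete_operated_module A M F P"
  shows "operated_module A M P" "\<And>n. submodule (F n) A M" "filtered_group M F"
    "F 0 = carrier M" "\<And>n. P ` F n \<subseteq> F (Suc n)"
    "filtered_group.separated M F" "filtered_group.cauchy_complete M F"
proof -
  show op: "operated_module A M P" and sub: "submodule (F n) A M" for n
    using assms by (auto simp: compatible_complete_operated_module_def
        complete_operated_module_def operated_submodule_def)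
  have "abelian_group M"
    using op by (simp add: operated_module_def Module.module_def)
  then interpret filtered_group M F
    using assms by (intro filtered_group.intro filtered_group_axioms.intro submodule_imp_subgroup[OF sub])
      (simp_all add: compatible_complete_operated_module_def complete_operated_module_def)
  show "filtered_group M F" ..
  have F: "F n = closed_operator_filtration A M F P n" for n
    using assms by (auto simp: compatible_complete_operated_module_def)
  show "F 0 = carrier M" using F[of 0] by simp
  show "P ` F n \<subseteq> F (Suc n)" for n
  proof -
    have P: "P ` F n \<subseteq> F n"
      using assms unfolding compatible_complete_operated_module_def
        complete_operated_module_def operated_submodule_def by blast
    then have "P ` F n \<subseteq> carrier M" using filt_carrier by blast
    \<comment> \<open>A set lies in its closure only if it lies in the space, so the generated
      submodule is first placed in the carrier.\<close>
    then have "submodule (carrier M) A M"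
      using F[of 0] sub[of 0] by simp
    then have "generated_submodule A M (P ` F n) \<subseteq> carrier M"
      using \<open>P ` F n \<subseteq> carrier M\<close> by (auto simp: generated_submodule_def)
    then have "generated_submodule A M (P ` F n) \<subseteq> F (Suc n)"
      unfolding F[of "Suc n"] closed_operator_filtration.simps F[of n, symmetric]
      by (intro closure_of_subset) (simp add: topspace_filtration_topology)
    moreover have "P ` F n \<subseteq> generated_submodule A M (P ` F n)"
      by (auto simp: generated_submodule_def)
    ultimately show ?thesis by blast
  qed
  show separated cauchy_complete
    using assms bij_betw_inverse_limit_iff
    by (simp_all add: compatible_complete_operated_module_def complete_operated_module_def)
qed

section \<open>The map from series of tensors to a complete Reynolds algebra\<close>

text \<open>Length 0 is reset to 0: the part of length one would otherwise become a scalar outside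
  S(\<real>).\<close>

definition shift_series :: "tseries \<Rightarrow> tseries"
  where "shift_series s = (\<lambda>k. if k = 0 then 0 else s (Suc k))"

text \<open>This is P_S on S(\<real>); the cut at length 1 makes it ignore a scalar
  component.\<close>

definition prepend_one :: "tseries \<Rightarrow> tseries"
  where "prepend_one s = (\<lambda>k. if k \<le> 1 then 0 else s (k - 1))"

lemma tseries_nth_0: "shift_series s 0 = 0" "prepend_one s 0 = 0" "ptensor [a] 0 = 0"
  by (simp_all add: shift_series_def prepend_one_def ptensor_def)

lemma shift_series_prepend_one: "s 0 = 0 \<Longrightarrow> shift_series (prepend_one s) = s"
  by (auto simp: shift_series_def prepend_one_def fun_eq_iff)

lemma prepend_one_shift_series:
  "s 0 = 0 \<Longrightarrow> s = (\<lambda>k. s 1 * ptensor [1] k + prepend_one (shift_series s) k)"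
  by (auto simp: shift_series_def prepend_one_def fun_eq_iff ptensor_def le_Suc_eq)

lemma shift_series_ptensor: "shift_series (\<lambda>k. c * ptensor [a] k) = (\<lambda>k. 0)"
  by (auto simp: shift_series_def ptensor_def fun_eq_iff)

lemma base_field_simps [simp]:
  "carrier base_field = UNIV" "a \<otimes>\<^bsub>base_field\<^esub> b = a * b" "a \<oplus>\<^bsub>base_field\<^esub> b = a + b"
  "\<one>\<^bsub>base_field\<^esub> = 1" "\<zero>\<^bsub>base_field\<^esub> = 0"
  by (simp_all add: base_field_def)

text \<open>The value D(1) = l 1 is already substituted into the Reynolds identity.\<close>

locale filtered_reynolds_algebra =
  filtered_group R F + A: algebra "base_field :: real ring" R
  for R :: "(real, 'r, 'm) module_scheme" (structure) and F +
  fixes P :: "'r \<Rightarrow> 'r" and l :: real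
  assumes P_closed [simp]: "x \<in> carrier R \<Longrightarrow> P x \<in> carrier R"
    and P_add: "\<lbrakk>x \<in> carrier R; y \<in> carrier R\<rbrakk> \<Longrightarrow> P (x \<oplus> y) = P x \<oplus> P y"
    and P_smult: "x \<in> carrier R \<Longrightarrow> P (c \<odot> x) = c \<odot> P x"
    and reynolds: "\<lbrakk>x \<in> carrier R; y \<in> carrier R\<rbrakk> \<Longrightarrow>
      P x \<otimes> P y = (P (P x \<otimes> y) \<oplus> P (x \<otimes> P y)) \<ominus> l \<odot> P (P x \<otimes> P y)"
    and filt_0: "F 0 = carrier R"
    and filt_smult: "x \<in> F n \<Longrightarrow> c \<odot> x \<in> F n"
    and P_filt: "x \<in> F n \<Longrightarrow> P x \<in> F (Suc n)"
    and separated: separated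
    and cauchy_complete: cauchy_complete
begin

lemma smult_closed [simp]: "x \<in> carrier R \<Longrightarrow> c \<odot> x \<in> carrier R"
  by (rule A.smult_closed) simp_all

lemma P_zero: "P \<zero> = \<zero>"
  using P_smult[of \<zero> 0] A.smult_l_null by simp

lemma minus_eq_smult: "x \<in> carrier R \<Longrightarrow> \<ominus> x = (-1) \<odot> x"
proof -
  assume x: "x \<in> carrier R"
  have "x \<oplus> (-1) \<odot> x = \<zero>"
    using A.smult_l_distr[of 1 "-1" x] A.smult_one[of x] A.smult_l_null[of x] x by simp
  then show ?thesis using x by (simp add: minus_equality a_comm)
qed

definition cong_filt :: "nat \<Rightarrow> 'r \<Rightarrow> 'r \<Rightarrow> bool"
  where "cong_filt n x y \<longleftrightarrow> x \<in> carrier R \<and> y \<in> carrier R \<and> x \<ominus> y \<in> F n"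

lemma cong_filt_0: "x \<in> carrier R \<Longrightarrow> y \<in> carrier R \<Longrightarrow> cong_filt 0 x y"
  by (simp add: cong_filt_def filt_0)

lemma cong_filt_refl: "x \<in> carrier R \<Longrightarrow> cong_filt n x x"
  by (simp add: cong_filt_def a_minus_def r_neg)

lemma cong_filt_sym: "cong_filt n x y \<Longrightarrow> cong_filt n y x"
  by (simp add: cong_filt_def filt_diff_commute)

lemma cong_filt_trans: "cong_filt n x y \<Longrightarrow> cong_filt n y z \<Longrightarrow> cong_filt n x z"
  using filt_diff_trans by (auto simp: cong_filt_def)

lemma cong_filt_add:
  assumes "cong_filt n x y" "cong_filt n x' y'"
  shows "cong_filt n (x \<oplus> x') (y \<oplus> y')"
proof -
  have "(x \<oplus> x') \<ominus> (y \<oplus> y') = (x \<ominus> y) \<oplus> (x' \<ominus> y')"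
    using assms by (simp add: cong_filt_def a_minus_def minus_add a_ac)
  then show ?thesis using assms by (auto simp: cong_filt_def)
qed

lemma cong_filt_smult:
  assumes "cong_filt n x y"
  shows "cong_filt n (c \<odot> x) (c \<odot> y)"
proof -
  have "c \<odot> x \<ominus> c \<odot> y = c \<odot> (x \<ominus> y)"
    using assms by (simp add: cong_filt_def a_minus_def A.smult_r_distr A.smult_r_minus)
  then show ?thesis using assms filt_smult by (simp add: cong_filt_def)
qed

lemma cong_filt_minus:
  assumes "cong_filt n x y" "cong_filt n x' y'"
  shows "cong_filt n (x \<ominus> x') (y \<ominus> y')"
proof -
  have "x' \<in> carrier R" "y' \<in> carrier R" using assms by (simp_all add: cong_filt_def)
  then show ?thesis
    using cong_filt_add[OF assms(1) cong_filt_smult[OF assms(2), of "-1"]]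
    by (simp only: a_minus_def minus_eq_smult)
qed

lemma cong_filt_P:
  assumes "cong_filt n x y"
  shows "cong_filt (Suc n) (P x) (P y)"
proof -
  have "P x \<ominus> P y = P (x \<ominus> y)"
    using assms by (simp add: cong_filt_def a_minus_def P_add P_smult minus_eq_smult)
  then show ?thesis using assms P_filt by (simp add: cong_filt_def)
qed

lemma cong_filt_imp_eq:
  assumes "\<And>n. cong_filt n x y"
  shows "x = y"
proof -
  have c: "x \<in> carrier R" "y \<in> carrier R" using assms by (auto simp: cong_filt_def)
  have "x \<ominus> y = \<zero>" using assms separated by (auto simp: cong_filt_def separated_def)
  then show "x = y" using c by (rule diff_zero_imp_eq)
qed

text \<open>Horner form of the partial sum of s(j+1) P^j(1) over j < n.\<close>

fun horner :: "tseries \<Rightarrow> nat \<Rightarrow> 'r"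
  where
    "horner s 0 = \<zero>"
  | "horner s (Suc n) = s 1 \<odot> \<one> \<oplus> P (horner (shift_series s) n)"

lemma horner_closed [simp]: "horner s n \<in> carrier R"
  by (induction s n rule: horner.induct) simp_all

lemma cong_filt_horner: "cong_filt n (horner s (Suc n)) (horner s n)"
proof (induction n arbitrary: s)
  case (Suc n)
  have "cong_filt (Suc n) (s 1 \<odot> \<one> \<oplus> P (horner (shift_series s) (Suc n)))
      (s 1 \<odot> \<one> \<oplus> P (horner (shift_series s) n))"
    by (intro cong_filt_add cong_filt_refl cong_filt_P Suc.IH) simp
  then show ?case by (simp only: horner.simps)
qed (simp add: cong_filt_0)

text \<open>The full sum of all s(j+1) P^j(1): completeness provides the limit, and separation makes
  the choice unique.\<close>

definition series_value :: "tseries \<Rightarrow> 'r"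
  where "series_value s = (SOME x. \<forall>n. cong_filt n x (horner s n))"

lemma cong_filt_series_value: "cong_filt n (series_value s) (horner s n)"
proof -
  have "\<exists>x\<in>carrier R. \<forall>n. x \<ominus> horner s n \<in> F n"
    using cauchy_complete cong_filt_horner
    unfolding cauchy_complete_def cong_filt_def by simp
  then have "\<exists>x. \<forall>n. cong_filt n x (horner s n)" by (auto simp: cong_filt_def)
  then have "\<forall>n. cong_filt n (series_value s) (horner s n)"
    unfolding series_value_def by (rule someI_ex)
  then show ?thesis ..
qed

lemma series_value_closed [simp]: "series_value s \<in> carrier R"
  using cong_filt_series_value by (auto simp: cong_filt_def)

lemma series_value_rec:
  "series_value s = s 1 \<odot> \<one> \<oplus> P (series_value (shift_series s))"
proof (rule cong_filt_imp_eq)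
  fix n
  show "cong_filt n (series_value s) (s 1 \<odot> \<one> \<oplus> P (series_value (shift_series s)))"
  proof (cases n)
    case 0
    then show ?thesis by (simp add: cong_filt_0)
  next
    case (Suc m)
    \<comment> \<open>Both sides are close to \<open>horner s (Suc m)\<close>, the right one because
      P gains one level.\<close>
    have "cong_filt (Suc m) (s 1 \<odot> \<one> \<oplus> P (series_value (shift_series s)))
        (s 1 \<odot> \<one> \<oplus> P (horner (shift_series s) m))"
      by (intro cong_filt_add cong_filt_refl cong_filt_P cong_filt_series_value) simp
    then show ?thesis
      unfolding Suc using cong_filt_trans[OF cong_filt_series_value cong_filt_sym]
      by (metis horner.simps(2))
  qed
qed

lemma series_value_filt: "\<forall>k\<le>n. s k = 0 \<Longrightarrow> series_value s \<in> F n"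
proof (induction n arbitrary: s)
  case (Suc n)
  have "\<forall>k\<le>n. shift_series s k = 0" using Suc.prems by (simp add: shift_series_def)
  then have "P (series_value (shift_series s)) \<in> F (Suc n)" by (intro P_filt Suc.IH)
  moreover have "s 1 = 0" using Suc.prems by simp
  ultimately show ?case
    by (subst series_value_rec) (use A.smult_l_null[of \<one>] in simp)
qed (simp add: filt_0)

text \<open>Both sides unfold to the same constant plus P of a pair of the same shape, so agreement
  modulo F n improves to F(n+1). The series are generalised because the recursion passes to their
  shifts.\<close>

lemma series_value_add: "series_value (\<lambda>k. s k + t k) = series_value s \<oplus> series_value t"
proof (rule cong_filt_imp_eq)
  show "cong_filt n (series_value (\<lambda>k. s k + t k)) (series_value s \<oplus> series_value t)" for n
  proof (induction n arbitrary: s t)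
    case (Suc n)
    let ?s = "shift_series s" and ?t = "shift_series t"
    have "shift_series (\<lambda>k. s k + t k) = (\<lambda>k. ?s k + ?t k)"
      by (auto simp: shift_series_def fun_eq_iff)
    then have 1: "series_value (\<lambda>k. s k + t k) =
        (s 1 + t 1) \<odot> \<one> \<oplus> P (series_value (\<lambda>k. ?s k + ?t k))"
      by (subst series_value_rec) simp
    have 2: "series_value s \<oplus> series_value t =
        (s 1 + t 1) \<odot> \<one> \<oplus> P (series_value ?s \<oplus> series_value ?t)"
      using series_value_rec[of s] series_value_rec[of t] A.smult_l_distr[of "s 1" "t 1" \<one>]
      by (simp add: P_add a_ac)
    show ?case
      unfolding 1 2 by (intro cong_filt_add cong_filt_refl cong_filt_P Suc.IH) simp
  qed (simp add: cong_filt_0)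
qed

lemma series_value_smult: "series_value (\<lambda>k. c * s k) = c \<odot> series_value s"
proof (rule cong_filt_imp_eq)
  show "cong_filt n (series_value (\<lambda>k. c * s k)) (c \<odot> series_value s)" for n
  proof (induction n arbitrary: s)
    case (Suc n)
    let ?s = "shift_series s"
    have "shift_series (\<lambda>k. c * s k) = (\<lambda>k. c * ?s k)"
      by (auto simp: shift_series_def fun_eq_iff)
    then have 1: "series_value (\<lambda>k. c * s k) = (c * s 1) \<odot> \<one> \<oplus> P (series_value (\<lambda>k. c * ?s k))"
      by (subst series_value_rec) simp
    have 2: "c \<odot> series_value s = (c * s 1) \<odot> \<one> \<oplus> P (c \<odot> series_value ?s)"
      using series_value_rec[of s] A.smult_assoc1[of c "s 1" \<one>]
      by (simp add: P_smult A.smult_r_distr)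
    show ?case
      unfolding 1 2 by (intro cong_filt_add cong_filt_refl cong_filt_P Suc.IH) simp
  qed (simp add: cong_filt_0)
qed

lemma series_value_diff: "series_value (\<lambda>k. s k - t k) = series_value s \<ominus> series_value t"
  using series_value_add[of s "\<lambda>k. (-1) * t k"]
  by (simp only: series_value_smult) (simp add: a_minus_def minus_eq_smult)

lemma series_value_zero: "series_value (\<lambda>k. 0) = \<zero>"
  using series_value_smult[of 0 "\<lambda>k. 0"] A.smult_l_null by simp

lemma series_value_ptensor: "series_value (ptensor [a]) = a \<odot> \<one>"
  using shift_series_ptensor[of 1 a]
  by (subst series_value_rec) (simp add: series_value_zero P_zero ptensor_def)

lemma series_value_prepend_one:
  assumes "s 0 = 0"
  shows "series_value (prepend_one s) = P (series_value s)"
proof -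
  have "prepend_one s 1 \<odot> \<one> = \<zero>"
    using A.smult_l_null[of \<one>] by (simp add: prepend_one_def)
  then show ?thesis
    by (subst series_value_rec) (simp add: shift_series_prepend_one assms)
qed

text \<open>By the Reynolds identity a product of two elements of the shape a 1 + P u has this shape
  again and can be compared with the recursion of \<open>series_value\<close>.\<close>

lemma product_expansion:
  assumes "u \<in> carrier R" "v \<in> carrier R"
  shows "(a \<odot> \<one> \<oplus> P u) \<otimes> (b \<odot> \<one> \<oplus> P v) =
    (a * b) \<odot> \<one> \<oplus>
      P ((a \<odot> v \<oplus> b \<odot> u) \<oplus> ((P u \<otimes> v \<oplus> u \<otimes> P v) \<ominus> l \<odot> (P u \<otimes> P v)))"
proof -
  have one: "(c \<odot> \<one>) \<otimes> x = c \<odot> x" "x \<otimes> (c \<odot> \<one>) = c \<odot> x" if "x \<in> carrier R" for x c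
    using that A.smult_assoc2[of c \<one> x] A.m_comm[of x "c \<odot> \<one>"] by simp_all
  have assoc: "a \<odot> (b \<odot> \<one>) = (a * b) \<odot> \<one>" "b \<odot> (a \<odot> \<one>) = (a * b) \<odot> \<one>"
    using A.smult_assoc1[of a b \<one>] A.smult_assoc1[of b a \<one>] by (simp_all add: mult.commute)
  have "(a \<odot> \<one> \<oplus> P u) \<otimes> (b \<odot> \<one> \<oplus> P v) =
      (a * b) \<odot> \<one> \<oplus> ((a \<odot> P v \<oplus> b \<odot> P u) \<oplus> P u \<otimes> P v)"
    using assms by (simp add: A.l_distr A.r_distr one A.smult_r_distr assoc a_ac)
  also have "(a \<odot> P v \<oplus> b \<odot> P u) \<oplus> P u \<otimes> P v =
      P ((a \<odot> v \<oplus> b \<odot> u) \<oplus> ((P u \<otimes> v \<oplus> u \<otimes> P v) \<ominus> l \<odot> (P u \<otimes> P v)))"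
    using assms reynolds[OF assms]
    by (simp add: P_add P_smult a_minus_def minus_eq_smult)
  finally show ?thesis .
qed

text \<open>The hypotheses describe what the recursion of \<open>series_value\<close> sees of a
  product: its first coefficient and its shift. The induction is on the accuracy; the factors on the
  right-hand side need not be shorter than the original ones.\<close>

lemma series_value_mult:
  fixes mul :: "tseries \<Rightarrow> tseries \<Rightarrow> tseries"
  assumes mul_1: "\<And>s t. mul s t 1 = s 1 * t 1"
    and mul_shift: "\<And>s t. shift_series (mul s t) = (\<lambda>k.
      (s 1 * shift_series t k + t 1 * shift_series s k) +
      ((mul (prepend_one (shift_series s)) (shift_series t) k +
        mul (shift_series s) (prepend_one (shift_series t)) k) -
       l * mul (prepend_one (shift_series s)) (prepend_one (shift_series t)) k))"
  shows "series_value (mul s t) = series_value s \<otimes> series_value t"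
proof (rule cong_filt_imp_eq)
  show "cong_filt n (series_value (mul s t)) (series_value s \<otimes> series_value t)" for n
  proof (induction n arbitrary: s t)
    case (Suc n)
    let ?s = "shift_series s" and ?t = "shift_series t"
    let ?Ps = "prepend_one ?s" and ?Pt = "prepend_one ?t"
    have P: "series_value ?Ps = P (series_value ?s)" "series_value ?Pt = P (series_value ?t)"
      by (simp_all add: series_value_prepend_one shift_series_def)
    have 1: "series_value (mul s t) = (s 1 * t 1) \<odot> \<one> \<oplus>
        P ((s 1 \<odot> series_value ?t \<oplus> t 1 \<odot> series_value ?s) \<oplus>
           ((series_value (mul ?Ps ?t) \<oplus> series_value (mul ?s ?Pt)) \<ominus> l \<odot> series_value (mul ?Ps ?Pt)))"
      by (subst series_value_rec)
        (simp only: mul_1 mul_shift series_value_add series_value_smult series_value_diff)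
    have 2: "series_value s \<otimes> series_value t = (s 1 * t 1) \<odot> \<one> \<oplus>
        P ((s 1 \<odot> series_value ?t \<oplus> t 1 \<odot> series_value ?s) \<oplus>
           ((series_value ?Ps \<otimes> series_value ?t \<oplus> series_value ?s \<otimes> series_value ?Pt) \<ominus>
            l \<odot> (series_value ?Ps \<otimes> series_value ?Pt)))"
      unfolding P
      by (subst (1 2) series_value_rec, rule product_expansion) simp_all
    show ?case
      unfolding 1 2
      by (intro cong_filt_add cong_filt_minus cong_filt_smult cong_filt_P Suc.IH cong_filt_refl)
        simp_all
  qed (simp add: cong_filt_0)
qed

text \<open>The recursion determines \<open>g\<close> modulo every F n, hence completely; this
  yields uniqueness of morphisms.\<close>

lemma eq_series_valueI:
  assumes g_closed: "\<And>s. s 0 = 0 \<Longrightarrow> g s \<in> carrier R"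
    and g_rec: "\<And>s. s 0 = 0 \<Longrightarrow> g s = s 1 \<odot> \<one> \<oplus> P (g (shift_series s))"
    and "s 0 = 0"
  shows "g s = series_value s"
proof (rule cong_filt_imp_eq)
  show "cong_filt n (g s) (series_value s)" for n
    using \<open>s 0 = 0\<close>
  proof (induction n arbitrary: s)
    case 0
    then show ?case by (simp add: cong_filt_0 g_closed)
  next
    case (Suc n)
    show ?case
      unfolding g_rec[of s, OF Suc.prems] series_value_rec[of s]
      by (intro cong_filt_add cong_filt_refl cong_filt_P Suc.IH) (simp_all add: shift_series_def)
  qed
qed

end

section \<open>Reduction of compatible algebras to filtered Reynolds algebras\<close>

lemma structure_module_simps [simp]:
  "carrier (structure_module R) = carrier R" "add (structure_module R) = add R"
  "zero (structure_module R) = zero R" "a_minus (structure_module R) = a_minus R"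
  "module.smult (structure_module R) a x = str R a \<otimes>\<^bsub>R\<^esub> x"
  by (simp_all add: structure_module_def fun_eq_iff a_minus_def a_inv_def m_inv_def)

lemma subgroup_structure_module:
  "subgroup N (add_monoid (structure_module R)) \<longleftrightarrow> subgroup N (add_monoid R)"
  by (simp add: subgroup_def m_inv_def)

lemma real_algebra_simps [simp]:
  "carrier real_algebra = UNIV" "a \<otimes>\<^bsub>real_algebra\<^esub> b = a * b" "a \<oplus>\<^bsub>real_algebra\<^esub> b = a + b"
  "\<one>\<^bsub>real_algebra\<^esub> = 1" "\<zero>\<^bsub>real_algebra\<^esub> = 0" "a \<odot>\<^bsub>real_algebra\<^esub> b = a * b"
  by (simp_all add: real_algebra_def)

lemma cring_base_field: "cring (base_field :: 'k::field_char_0 ring)"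
  by (intro cringI abelian_groupI comm_monoidI)
    (auto simp: base_field_def algebra_simps intro: exI[of _ "- x" for x])

lemma cring_real_algebra: "cring real_algebra"
  by (intro cringI abelian_groupI comm_monoidI) (auto simp: algebra_simps intro: exI[of _ "- x" for x])

lemma k_algebra_real_algebra: "k_algebra real_algebra"
  by (intro algebraI cring_base_field cring_real_algebra) (simp_all add: algebra_simps)

text \<open>Subtraction in a record rests on a description of the inverse; here a proposed
  difference is verified by adding back.\<close>

lemma a_minus_eqI:
  assumes "abelian_group G" "x \<in> carrier G" "y \<in> carrier G" "z \<in> carrier G" "z \<oplus>\<^bsub>G\<^esub> y = x"
  shows "x \<ominus>\<^bsub>G\<^esub> y = z"
proof -
  interpret abelian_group G by fact
  show ?thesis using assms(2-4) unfolding assms(5)[symmetric] by (simp add: a_minus_def a_assoc r_neg)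
qed

lemma unit_modified_real_algebra: "unit_modified_differential_algebra real_algebra (\<lambda>a. l * a)"
proof -
  have minus: "x \<ominus>\<^bsub>real_algebra\<^esub> y = x - y" for x y
    by (rule a_minus_eqI) (simp_all add: ring.is_abelian_group cring.axioms cring_real_algebra)
  show ?thesis
    by (simp add: unit_modified_differential_algebra_def k_algebra_real_algebra k_linear_def minus)
      (simp add: algebra_simps)
qed

lemma algebra_hom_real_algebra:
  assumes "k_algebra R" "f \<in> algebra_hom real_algebra R"
  shows "f a = a \<odot>\<^bsub>R\<^esub> \<one>\<^bsub>R\<^esub>"
proof -
  have "\<forall>c x. f (c * x) = c \<odot>\<^bsub>R\<^esub> f x"
    using assms(2) by (simp add: algebra_hom_def k_linear_def)
  then have "f a = a \<odot>\<^bsub>R\<^esub> f \<one>\<^bsub>real_algebra\<^esub>"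
    by (metis mult.right_neutral real_algebra_simps(4))
  also have "f \<one>\<^bsub>real_algebra\<^esub> = \<one>\<^bsub>R\<^esub>"
    using assms(2) unfolding algebra_hom_def ring_hom_def by blast
  finally show ?thesis by simp
qed

text \<open>The structure map is linear and unital, hence sends a to a 1.\<close>

lemma str_mult:
  assumes R: "k_algebra R" and str: "str R \<in> algebra_hom real_algebra R" and x: "x \<in> carrier R"
  shows "str R a \<otimes>\<^bsub>R\<^esub> x = a \<odot>\<^bsub>R\<^esub> x"
proof -
  interpret algebra base_field R by (rule R)
  show ?thesis
    using smult_assoc2[of a "\<one>\<^bsub>R\<^esub>" x] x by (simp add: algebra_hom_real_algebra[OF R str])
qed

text \<open>Evaluating i_R d = D i_R at 1 gives D(1) = d(1) 1. The last Reynolds term thereby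
  becomes a scalar multiple of P(P(x)P(y)).\<close>

lemma cdr_imp_filtered_reynolds_algebra:
  assumes cdr: "compatible_differential_reynolds_algebra real_algebra d R"
  shows "filtered_reynolds_algebra R (filt R) (rey R) (d 1)"
    and "\<And>a. str R a = a \<odot>\<^bsub>R\<^esub> \<one>\<^bsub>R\<^esub>"
    and "der R \<one>\<^bsub>R\<^esub> = d 1 \<odot>\<^bsub>R\<^esub> \<one>\<^bsub>R\<^esub>"
proof -
  have R: "k_algebra R" and P: "k_linear R R (rey R)" and D: "k_linear R R (der R)"
    and rey: "\<And>x y. x \<in> carrier R \<Longrightarrow> y \<in> carrier R \<Longrightarrow> rey R x \<otimes>\<^bsub>R\<^esub> rey R y =
        (rey R (rey R x \<otimes>\<^bsub>R\<^esub> y) \<oplus>\<^bsub>R\<^esub> rey R (x \<otimes>\<^bsub>R\<^esub> rey R y)) \<ominus>\<^bsub>R\<^esub>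
        rey R ((rey R x \<otimes>\<^bsub>R\<^esub> der R \<one>\<^bsub>R\<^esub>) \<otimes>\<^bsub>R\<^esub> rey R y)"
    and str: "str R \<in> algebra_hom real_algebra R"
    and str_d: "\<And>a. str R (d a) = der R (str R a)"
    and comp: "compatible_complete_operated_module real_algebra (structure_module R) (filt R) (rey R)"
    using cdr by (auto simp: compatible_differential_reynolds_algebra_def
        differential_reynolds_algebra_def unit_modified_differential_algebra_def)
  interpret A: algebra base_field R by (rule R)
  show str_eq: "str R a = a \<odot>\<^bsub>R\<^esub> \<one>\<^bsub>R\<^esub>" for a
    by (rule algebra_hom_real_algebra[OF R str])
  have "str R 1 = \<one>\<^bsub>R\<^esub>" using str_eq[of 1] A.smult_one[of "\<one>\<^bsub>R\<^esub>"] by simp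
  then show D1: "der R \<one>\<^bsub>R\<^esub> = d 1 \<odot>\<^bsub>R\<^esub> \<one>\<^bsub>R\<^esub>"
    using str_d[of 1] str_eq[of "d 1"] by simp
  note M = compatible_complete_operated_moduleD[OF comp]
  interpret SM: filtered_group "structure_module R" "filt R" by (rule M(3))
  interpret filtered_group R "filt R"
    by (intro filtered_group.intro filtered_group_axioms.intro A.is_abelian_group SM.filt_decseq
        subgroup_structure_module[THEN iffD1, OF SM.filt_subgroup])
  have P_closed: "x \<in> carrier R \<Longrightarrow> rey R x \<in> carrier R" for x
    using P by (auto simp: k_linear_def)
  have P_smult: "x \<in> carrier R \<Longrightarrow> rey R (c \<odot>\<^bsub>R\<^esub> x) = c \<odot>\<^bsub>R\<^esub> rey R x" for c x
    using P by (simp add: k_linear_def)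
  show "filtered_reynolds_algebra R (filt R) (rey R) (d 1)"
  proof unfold_locales
    fix x y assume xy: "x \<in> carrier R" "y \<in> carrier R"
    show "rey R (x \<oplus>\<^bsub>R\<^esub> y) = rey R x \<oplus>\<^bsub>R\<^esub> rey R y"
      using P xy by (simp add: k_linear_def)
    have e: "(rey R x \<otimes>\<^bsub>R\<^esub> der R \<one>\<^bsub>R\<^esub>) \<otimes>\<^bsub>R\<^esub> rey R y = d 1 \<odot>\<^bsub>R\<^esub> (rey R x \<otimes>\<^bsub>R\<^esub> rey R y)"
      unfolding D1
      using xy P_closed A.smult_assoc2[of "d 1"] A.m_comm[of "rey R x" "d 1 \<odot>\<^bsub>R\<^esub> \<one>\<^bsub>R\<^esub>"] by simp
    have "rey R (d 1 \<odot>\<^bsub>R\<^esub> (rey R x \<otimes>\<^bsub>R\<^esub> rey R y)) = d 1 \<odot>\<^bsub>R\<^esub> rey R (rey R x \<otimes>\<^bsub>R\<^esub> rey R y)"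
      using P_smult xy P_closed by simp
    then show "rey R x \<otimes>\<^bsub>R\<^esub> rey R y = rey R (rey R x \<otimes>\<^bsub>R\<^esub> y) \<oplus>\<^bsub>R\<^esub> rey R (x \<otimes>\<^bsub>R\<^esub> rey R y) \<ominus>\<^bsub>R\<^esub>
        d 1 \<odot>\<^bsub>R\<^esub> rey R (rey R x \<otimes>\<^bsub>R\<^esub> rey R y)"
      using rey[OF xy, unfolded e] by metis
  next
    fix x n c assume x: "x \<in> filt R n"
    then have "str R c \<otimes>\<^bsub>R\<^esub> x \<in> filt R n"
      using submodule.smult_closed[OF M(2)[of n], of c x] by simp
    then show "c \<odot>\<^bsub>R\<^esub> x \<in> filt R n"
      using str_mult[OF R str] x filt_carrier by simp
  next
    show separated using M(6) by (simp add: separated_def SM.separated_def)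
    show cauchy_complete using M(7) by (simp add: cauchy_complete_def SM.cauchy_complete_def)
  qed (use P_closed P_smult M(4,5) in \<open>auto simp: image_subset_iff\<close>)
qed

text \<open>The base acts by scalars, so the module and submodule axioms reduce to those of a real
  vector space and its subspaces.\<close>

lemma compatible_differential_reynolds_algebraI:
  assumes base: "unit_modified_differential_algebra real_algebra d"
    and DR: "differential_reynolds_algebra R (der R) (rey R)"
    and str: "str R \<in> algebra_hom real_algebra R" "\<And>a. str R (d a) = der R (str R a)"
    and F_Suc: "\<And>n. filt R (Suc n) = rey R ` filt R n"
    and F_0: "filt R 0 = carrier R"
    and F_dec: "\<And>n. filt R (Suc n) \<subseteq> filt R n"
    and F_add: "\<And>n x y. x \<in> filt R n \<Longrightarrow> y \<in> filt R n \<Longrightarrow> x \<oplus>\<^bsub>R\<^esub> y \<in> filt R n"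
    and F_smult: "\<And>n c x. x \<in> filt R n \<Longrightarrow> c \<odot>\<^bsub>R\<^esub> x \<in> filt R n"
    and F_zero: "\<And>n. \<zero>\<^bsub>R\<^esub> \<in> filt R n"
    and sep: "\<And>x. \<forall>n. x \<in> filt R n \<Longrightarrow> x = \<zero>\<^bsub>R\<^esub>"
    and com: "\<And>X. \<forall>n. X n \<in> carrier R \<Longrightarrow> \<forall>n. X (Suc n) \<ominus>\<^bsub>R\<^esub> X n \<in> filt R n \<Longrightarrow>
      \<exists>x\<in>carrier R. \<forall>n. x \<ominus>\<^bsub>R\<^esub> X n \<in> filt R n"
  shows "compatible_differential_reynolds_algebra real_algebra d R"
proof -
  have R: "k_algebra R" and P: "k_linear R R (rey R)"
    using DR by (auto simp: differential_reynolds_algebra_def unit_modified_differential_algebra_def)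
  interpret A: algebra base_field R by (rule R)
  let ?M = "structure_module R"
  have dec: "decseq (filt R)" using F_dec by (simp add: decseq_Suc_iff)
  have carr: "x \<in> carrier R" if "x \<in> filt R n" for n x
    using that decseqD[OF dec, of 0 n] F_0 by auto
  have smult: "str R a \<otimes>\<^bsub>R\<^esub> x = a \<odot>\<^bsub>R\<^esub> x" if "x \<in> carrier R" for a x
    by (rule str_mult[OF R str(1) that])
  have group: "abelian_group ?M"
  proof (rule abelian_groupI)
    show "\<exists>y\<in>carrier ?M. y \<oplus>\<^bsub>?M\<^esub> x = \<zero>\<^bsub>?M\<^esub>" if "x \<in> carrier ?M" for x
      using that by (intro bexI[of _ "\<ominus>\<^bsub>R\<^esub> x"]) (simp_all add: A.l_neg)
  qed (simp_all add: A.a_ac)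
  have module: "Module.module real_algebra ?M"
  proof (intro moduleI cring_real_algebra group)
    fix a b x y
    assume "x \<in> carrier ?M" "y \<in> carrier ?M"
    then show "a \<odot>\<^bsub>?M\<^esub> (x \<oplus>\<^bsub>?M\<^esub> y) = a \<odot>\<^bsub>?M\<^esub> x \<oplus>\<^bsub>?M\<^esub> a \<odot>\<^bsub>?M\<^esub> y"
      by (simp add: smult A.smult_r_distr)
  next
    fix a b x assume x: "x \<in> carrier ?M"
    then show "(a \<otimes>\<^bsub>real_algebra\<^esub> b) \<odot>\<^bsub>?M\<^esub> x = a \<odot>\<^bsub>?M\<^esub> (b \<odot>\<^bsub>?M\<^esub> x)"
      using A.smult_assoc1[of a b x] A.smult_closed[of b x] by (simp add: smult)
    show "(a \<oplus>\<^bsub>real_algebra\<^esub> b) \<odot>\<^bsub>?M\<^esub> x = a \<odot>\<^bsub>?M\<^esub> x \<oplus>\<^bsub>?M\<^esub> b \<odot>\<^bsub>?M\<^esub> x"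
      using x A.smult_l_distr[of a b x] by (simp add: smult)
  next
    fix x assume "x \<in> carrier ?M"
    then show "\<one>\<^bsub>real_algebra\<^esub> \<odot>\<^bsub>?M\<^esub> x = x"
      using A.smult_one[of x] by (simp add: smult)
  qed (simp add: smult)
  interpret M: Module.module real_algebra ?M by (rule module)
  have sub: "submodule (filt R n) real_algebra ?M" for n
  proof (rule M.submoduleI)
    fix a assume a: "a \<in> filt R n"
    then have "\<ominus>\<^bsub>?M\<^esub> a = (- 1) \<odot>\<^bsub>R\<^esub> a"
      using carr[OF a] M.smult_l_minus[of 1 a] M.smult_one[of a] M.R.minus_equality[of "-1" 1]
      by (simp add: smult)
    then show "\<ominus>\<^bsub>?M\<^esub> a \<in> filt R n" using F_smult[OF a] by simp
  qed (use carr F_zero F_add F_smult in \<open>auto simp: smult\<close>)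
  have "operated_module real_algebra ?M (rey R)"
    unfolding operated_module_def
  proof (intro conjI k_algebra_real_algebra module)
    show "k_linear (restrict_scalars real_algebra ?M) (restrict_scalars real_algebra ?M) (rey R)"
      using P by (auto simp: k_linear_def restrict_scalars_def smult Pi_iff)
  qed
  moreover have G: "filtered_group ?M (filt R)"
    by (intro filtered_group.intro filtered_group_axioms.intro group dec submodule_imp_subgroup[OF sub])
  moreover have "filtered_group.separated ?M (filt R)"
    using sep by (simp add: filtered_group.separated_def[OF G])
  moreover have "filtered_group.cauchy_complete ?M (filt R)"
    using com by (simp add: filtered_group.cauchy_complete_def[OF G])
  ultimately have "compatible_complete_operated_module real_algebra ?M (filt R) (rey R)"
    by (intro compatible_complete_operated_moduleI sub dec F_Suc) (simp_all add: F_0)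
  then show ?thesis
    using base DR str by (simp add: compatible_differential_reynolds_algebra_def)
qed

section \<open>The algebra of power series\<close>

lemma power_series_cdr_simps [simp]:
  "carrier (power_series_cdr k h) = UNIV" "f \<otimes>\<^bsub>power_series_cdr k h\<^esub> g = f * g"
  "f \<oplus>\<^bsub>power_series_cdr k h\<^esub> g = f + g" "\<one>\<^bsub>power_series_cdr k h\<^esub> = 1"
  "\<zero>\<^bsub>power_series_cdr k h\<^esub> = 0" "c \<odot>\<^bsub>power_series_cdr k h\<^esub> f = fps_const c * f"
  "der (power_series_cdr k h) = D_K k h" "rey (power_series_cdr k h) = P_K k h"
  "str (power_series_cdr k h) = fps_const"
  by (simp_all add: power_series_cdr_def)

lemma range_fps_X_power_mult:
  "range (\<lambda>g :: 'a::comm_ring_1 fps. fps_X ^ n * g) = {f. \<forall>i<n. fps_nth f i = 0}"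
proof (intro equalityI subsetI)
  fix f :: "'a fps" assume "f \<in> {f. \<forall>i<n. fps_nth f i = 0}"
  then have "f = fps_X ^ n * fps_shift n f"
    by (intro fps_ext) (simp add: fps_X_power_mult_nth)
  then show "f \<in> range (\<lambda>g. fps_X ^ n * g)" by blast
qed (auto simp: fps_X_power_mult_nth)

lemma filt_power_series_cdr: "filt (power_series_cdr k h) n = {f. \<forall>i<n. fps_nth f i = 0}"
  by (simp add: power_series_cdr_def range_fps_X_power_mult)

lemma k_algebra_power_series_cdr: "k_algebra (power_series_cdr k h)"
proof (intro algebraI cring_base_field)
  show "cring (power_series_cdr k h)"
    by (intro cringI abelian_groupI comm_monoidI)
      (auto simp: algebra_simps intro: exI[of _ "- x" for x])
qed (simp_all add: algebra_simps flip: fps_const_add fps_const_mult)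

lemma minus_power_series_cdr [simp]: "f \<ominus>\<^bsub>power_series_cdr k h\<^esub> g = f - g"
proof -
  interpret algebra base_field "power_series_cdr k h" by (rule k_algebra_power_series_cdr)
  show ?thesis by (rule a_minus_eqI) (simp_all add: is_abelian_group)
qed

lemma fps_mult_nth_low_eq_0:
  fixes u f :: "'a::field fps"
  assumes "\<And>i. i < n \<Longrightarrow> fps_nth f i = 0" "i < n"
  shows "fps_nth (u * f) i = 0"
  using assms by (simp add: fps_mult_nth)

context
  fixes k h :: "real fps" and \<mu> :: real
  assumes k0: "fps_nth k 0 \<noteq> 0" and k1: "fps_nth k 1 \<noteq> 0" and \<mu>: "\<mu> \<noteq> 0"
    and h: "h = fps_const \<mu> * fps_deriv (1 / k)"
begin

lemma inverse_k: "inverse k * k = 1" "k * inverse k = 1"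
  using k0 inverse_mult_eq_1[of k] by (simp_all add: mult.commute)

lemma h_eq: "h = fps_const \<mu> * fps_deriv (inverse k)"
  using h k0 by (simp add: fps_divide_unit)

text \<open>The constant term is -\<mu> k_1 / k_0^2; here the assumptions on \<mu> and on the linear
  coefficient of k enter.\<close>

lemma h0: "fps_nth h 0 \<noteq> 0"
proof -
  have "fps_deriv (inverse k) = - fps_deriv k * (inverse k)\<^sup>2"
    by (rule fps_inverse_deriv[OF k0])
  then have "fps_nth h 0 = \<mu> * (- fps_nth k 1 * (inverse (fps_nth k 0))\<^sup>2)"
    by (simp add: h_eq power2_eq_square)
  then show ?thesis using k0 k1 \<mu> by simp
qed

lemma inverse_h: "inverse h * h = 1" "h * inverse h = 1"
  using h0 inverse_mult_eq_1[of h] by (simp_all add: mult.commute)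

lemma D_K_eq: "D_K k h f = inverse h * fps_deriv (f * inverse k)"
  using k0 h0 by (simp add: D_K_def fps_divide_unit)

lemma D_K_P_K: "D_K k h (P_K k h f) = f"
proof -
  have "P_K k h f * inverse k = fps_integral0 (h * f) * (k * inverse k)"
    by (simp add: P_K_def mult_ac)
  then have "D_K k h (P_K k h f) = (inverse h * h) * f"
    by (simp add: D_K_eq inverse_k fps_deriv_fps_integral mult.assoc)
  then show ?thesis by (simp add: inverse_h)
qed

text \<open>The quotient f/k also vanishes at 0, so integrating its derivative from 0 recovers
  it.\<close>

lemma P_K_D_K:
  assumes "fps_nth f 0 = 0"
  shows "P_K k h (D_K k h f) = f"
proof -
  have "P_K k h (D_K k h f) = k * fps_integral0 ((h * inverse h) * fps_deriv (f * inverse k))"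
    by (simp add: P_K_def D_K_eq mult.assoc)
  also have "\<dots> = k * (f * inverse k)"
    using assms by (simp add: inverse_h fps_integral0_deriv del: fps_deriv_mult)
  also have "\<dots> = (k * inverse k) * f" by (simp only: mult_ac)
  finally show ?thesis by (simp add: inverse_k)
qed

lemma P_K_nth_0 [simp]: "fps_nth (P_K k h f) 0 = 0"
  by (simp add: P_K_def)

lemma P_K_add: "P_K k h (f + g) = P_K k h f + P_K k h g"
  by (simp add: P_K_def distrib_left fps_integral0_add)

lemma P_K_const: "P_K k h (fps_const c * f) = fps_const c * P_K k h f"
proof -
  have "h * (fps_const c * f) = fps_const c * (h * f)" by (simp add: mult_ac)
  then have "fps_integral0 (h * (fps_const c * f)) = fps_const c * fps_integral0 (h * f)"
    by (simp only: fps_integral0_fps_const_mult_left)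
  then show ?thesis by (simp only: P_K_def mult.left_commute)
qed

lemma P_K_diff: "P_K k h (f - g) = P_K k h f - P_K k h g"
  using P_K_add[of f "fps_const (-1) * g"] P_K_const[of "-1" g]
  by (simp flip: fps_const_neg)

lemma D_K_add: "D_K k h (f + g) = D_K k h f + D_K k h g"
  by (simp add: D_K_eq algebra_simps)

lemma D_K_const: "D_K k h (fps_const c * f) = fps_const c * D_K k h f"
  by (simp add: D_K_eq algebra_simps)

text \<open>The reason for the choice of h: (1/k)' = h/\<mu>, which makes D_K(1) a constant matching
  the base operator.\<close>

lemma D_K_1: "D_K k h 1 = fps_const (inverse \<mu>)"
proof -
  have "fps_const (inverse \<mu>) * h = fps_deriv (inverse k)"
    using \<mu> by (simp add: h_eq flip: mult.assoc)
  then have "D_K k h 1 = fps_const (inverse \<mu>) * (inverse h * h)"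
    by (simp add: D_K_eq mult_ac)
  then show ?thesis by (simp add: inverse_h)
qed

text \<open>Product rule: (fg/k)' = (f/k)' g + f (g/k)' - f g (1/k)', and (1/k)'/h is
  D_K(1).\<close>

lemma D_K_mult:
  "D_K k h (f * g) = D_K k h f * g + f * D_K k h g - f * D_K k h 1 * g"
  by (simp add: D_K_eq algebra_simps)

text \<open>The product vanishes at 0, hence is P_K D_K of itself; the modified Leibniz rule and D_K
  P_K = id evaluate the inner D_K.\<close>

lemma P_K_reynolds:
  "P_K k h f * P_K k h g =
    P_K k h (P_K k h f * g) + P_K k h (f * P_K k h g) - P_K k h (P_K k h f * D_K k h 1 * P_K k h g)"
proof -
  have "P_K k h f * P_K k h g = P_K k h (D_K k h (P_K k h f * P_K k h g))"
    by (rule P_K_D_K[symmetric]) simp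
  also have "D_K k h (P_K k h f * P_K k h g) =
      P_K k h f * g + f * P_K k h g - P_K k h f * D_K k h 1 * P_K k h g"
    by (simp add: D_K_mult D_K_P_K add.commute)
  finally show ?thesis by (simp add: P_K_add P_K_diff)
qed

text \<open>Since k and h are units, P_K raises orders by exactly one, as integration does, and D_K
  supplies preimages. The criterion for compatibility asks for this equality.\<close>

lemma P_K_image_filt:
  "P_K k h ` filt (power_series_cdr k h) n = filt (power_series_cdr k h) (Suc n)"
proof (intro equalityI subsetI)
  fix f assume "f \<in> P_K k h ` filt (power_series_cdr k h) n"
  then obtain g where g: "\<And>i. i < n \<Longrightarrow> fps_nth g i = 0" and f: "f = P_K k h g"
    by (auto simp: filt_power_series_cdr)
  have "fps_nth (fps_integral0 (h * g)) i = 0" if "i < Suc n" for i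
    using that fps_mult_nth_low_eq_0[OF g] by (cases i) (simp_all add: fps_integral_def)
  then show "f \<in> filt (power_series_cdr k h) (Suc n)"
    unfolding filt_power_series_cdr f P_K_def using fps_mult_nth_low_eq_0 by blast
next
  fix f assume "f \<in> filt (power_series_cdr k h) (Suc n)"
  then have f: "\<And>i. i < Suc n \<Longrightarrow> fps_nth f i = 0" by (auto simp: filt_power_series_cdr)
  have "fps_nth (f * inverse k) i = 0" if "i < Suc n" for i
    using fps_mult_nth_low_eq_0[OF f that, of "inverse k"] by (simp add: mult.commute)
  then have "fps_nth (fps_deriv (f * inverse k)) i = 0" if "i < n" for i
    using that by (simp del: fps_deriv_mult)
  then have "D_K k h f \<in> filt (power_series_cdr k h) n"
    unfolding filt_power_series_cdr D_K_eq using fps_mult_nth_low_eq_0 by blast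
  moreover have "f = P_K k h (D_K k h f)" using f[of 0] by (simp add: P_K_D_K)
  ultimately show "f \<in> P_K k h ` filt (power_series_cdr k h) n" by blast
qed

lemma compatible_power_series_cdr:
  "compatible_differential_reynolds_algebra real_algebra (\<lambda>a. inverse \<mu> * a) (power_series_cdr k h)"
proof (rule compatible_differential_reynolds_algebraI)
  show "differential_reynolds_algebra (power_series_cdr k h)
      (der (power_series_cdr k h)) (rey (power_series_cdr k h))"
    unfolding differential_reynolds_algebra_def unit_modified_differential_algebra_def
  proof (intro conjI ballI k_algebra_power_series_cdr)
    fix x y
    show "der (power_series_cdr k h) (x \<otimes>\<^bsub>power_series_cdr k h\<^esub> y) =
        der (power_series_cdr k h) x \<otimes>\<^bsub>power_series_cdr k h\<^esub> y \<oplus>\<^bsub>power_series_cdr k h\<^esub>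
        x \<otimes>\<^bsub>power_series_cdr k h\<^esub> der (power_series_cdr k h) y \<ominus>\<^bsub>power_series_cdr k h\<^esub>
        x \<otimes>\<^bsub>power_series_cdr k h\<^esub> der (power_series_cdr k h) \<one>\<^bsub>power_series_cdr k h\<^esub>
          \<otimes>\<^bsub>power_series_cdr k h\<^esub> y"
      unfolding power_series_cdr_simps minus_power_series_cdr by (rule D_K_mult)
    show "rey (power_series_cdr k h) x \<otimes>\<^bsub>power_series_cdr k h\<^esub> rey (power_series_cdr k h) y =
        rey (power_series_cdr k h) (rey (power_series_cdr k h) x \<otimes>\<^bsub>power_series_cdr k h\<^esub> y)
          \<oplus>\<^bsub>power_series_cdr k h\<^esub>
        rey (power_series_cdr k h) (x \<otimes>\<^bsub>power_series_cdr k h\<^esub> rey (power_series_cdr k h) y)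
          \<ominus>\<^bsub>power_series_cdr k h\<^esub>
        rey (power_series_cdr k h) (rey (power_series_cdr k h) x \<otimes>\<^bsub>power_series_cdr k h\<^esub>
          der (power_series_cdr k h) \<one>\<^bsub>power_series_cdr k h\<^esub>
          \<otimes>\<^bsub>power_series_cdr k h\<^esub> rey (power_series_cdr k h) y)"
      unfolding power_series_cdr_simps minus_power_series_cdr by (rule P_K_reynolds)
  qed (simp_all add: k_linear_def D_K_add D_K_const P_K_add P_K_const D_K_P_K)
  show "str (power_series_cdr k h) \<in> algebra_hom real_algebra (power_series_cdr k h)"
    by (auto simp: algebra_hom_def k_linear_def ring_hom_def)
  show "str (power_series_cdr k h) (inverse \<mu> * a) =
      der (power_series_cdr k h) (str (power_series_cdr k h) a)" for a
    using D_K_const[of a 1] by (simp add: D_K_1 mult.commute)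
  show "filt (power_series_cdr k h) (Suc n) = rey (power_series_cdr k h) ` filt (power_series_cdr k h) n"
    for n by (simp add: P_K_image_filt)
next
  fix X :: "nat \<Rightarrow> real fps"
  assume "\<forall>n. X (Suc n) \<ominus>\<^bsub>power_series_cdr k h\<^esub> X n \<in> filt (power_series_cdr k h) n"
  then have X: "\<And>n i. i < n \<Longrightarrow> fps_nth (X (Suc n)) i = fps_nth (X n) i"
    by (simp add: filt_power_series_cdr)
  \<comment> \<open>Consecutive terms agree strictly below index n, so coefficient i is final from
    \<open>X (Suc i)\<close> on.\<close>
  have "fps_nth (X n) i = fps_nth (X (Suc i)) i" if "Suc i \<le> n" for n i
    using that by (induction n rule: dec_induct) (simp_all add: X)
  then have "fps_nth (X (Suc i)) i - fps_nth (X n) i = 0" if "i < n" for n i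
    using that by (metis Suc_leI diff_self)
  then show "\<exists>x\<in>carrier (power_series_cdr k h). \<forall>n.
      x \<ominus>\<^bsub>power_series_cdr k h\<^esub> X n \<in> filt (power_series_cdr k h) n"
    by (intro bexI[of _ "Abs_fps (\<lambda>i. fps_nth (X (Suc i)) i)"]) (simp_all add: filt_power_series_cdr)
next
  fix f assume "\<forall>n. f \<in> filt (power_series_cdr k h) n"
  then show "f = \<zero>\<^bsub>power_series_cdr k h\<^esub>"
    by (auto simp: filt_power_series_cdr fps_eq_iff)
qed (auto simp: filt_power_series_cdr unit_modified_real_algebra)

end

section \<open>The algebra \<open>S(\<real>)\<close>\<close>

lemma lin_ext_Cons_nth:
  "lin_ext (\<lambda>ws. ptensor (c # ws)) s k = (if k = 0 then 0 else c * s (k - 1))"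
proof -
  have "lin_ext (\<lambda>ws. ptensor (c # ws)) s k =
      Sum_any (\<lambda>m. if m = k - 1 then if k = 0 then 0 else c * s m else 0)"
    unfolding lin_ext_def ptensor_def
    by (intro arg_cong[where f = Sum_any] ext) (auto simp: prod_list_replicate)
  also have "\<dots> = (if k = 0 then 0 else c * s (k - 1))" by simp
  finally show ?thesis .
qed

lemma lin_ext_rey_S: "s 0 = 0 \<Longrightarrow> lin_ext rey_S s = prepend_one s"
  unfolding rey_S_def by (auto simp: fun_eq_iff lin_ext_Cons_nth prepend_one_def le_Suc_eq)

text \<open>On a tensor of at least two ones the outer terms of D_S cancel, and the middle one
  removes a factor.\<close>

lemma lin_ext_der_S:
  "lin_ext (der_S d) s = (\<lambda>k. s 1 * ptensor [d 1] k + shift_series s k)"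
proof
  fix k
  have T: "der_S d (replicate m 1) k =
      (if m = 1 \<and> k = 1 then d 1 else 0) + (if m = Suc k \<and> k > 0 then 1 else 0)" for m
  proof (cases m)
    case (Suc m')
    then show ?thesis
      by (cases m') (auto simp: ptensor_def prod_list_replicate)
  qed simp
  have "lin_ext (der_S d) s k = (\<Sum>m\<in>{1, Suc k}. s m * der_S d (replicate m 1) k)"
    unfolding lin_ext_def by (rule Sum_any.expand_superset) (auto simp: T)
  also have "\<dots> = s 1 * ptensor [d 1] k + shift_series s k"
    by (cases "k = 0") (auto simp: T ptensor_def shift_series_def)
  finally show "lin_ext (der_S d) s k = s 1 * ptensor [d 1] k + shift_series s k" .
qed

lemma diamond_ones:
  "diamond d [] bs k = 0" "diamond d as [] k = 0"
  "diamond d (replicate (Suc m) 1) (replicate (Suc n) 1) 0 = 0"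
  "diamond d (replicate (Suc m) 1) (replicate (Suc n) 1) (Suc k) = shuffle_coeff (d 1) m n k"
  by (cases as; simp add: lin_ext_Cons_nth shuffle_coeff_def)+

lemma bilin_ext_diamond_nth_0: "bilin_ext (diamond d) s t 0 = 0"
proof -
  have "diamond d (replicate m 1) (replicate n 1) 0 = 0" for m n
    by (cases m; cases n) (simp_all add: diamond_ones del: replicate_Suc)
  then show ?thesis by (simp add: bilin_ext_def)
qed

text \<open>Nonzero structure constants have m + n \<le> k, so all bounds from k on give the same
  sum; this freedom later aligns the index ranges of different products.\<close>

lemma bilin_ext_diamond_nth_Suc:
  assumes "k \<le> M" "k \<le> N"
  shows "bilin_ext (diamond d) s t (Suc k) =
    (\<Sum>m\<le>M. \<Sum>n\<le>N. s (Suc m) * t (Suc n) * shuffle_coeff (d 1) m n k)"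
proof -
  let ?g = "\<lambda>(m, n). s m * t n * diamond d (replicate m 1) (replicate n 1) (Suc k)"
  let ?A = "Suc ` {..M} \<times> Suc ` {..N}"
  have 0: "?g (m, n) = 0" if "(m, n) \<notin> ?A" for m n
  proof (cases "m = 0 \<or> n = 0")
    case False
    then obtain m' n' where mn: "m = Suc m'" "n = Suc n'" by (metis not0_implies_Suc)
    then have "k < m' + n'" using that assms by auto
    then show ?thesis
      unfolding mn by (simp add: diamond_ones shuffle_coeff_eq_0 del: replicate_Suc)
  qed (use diamond_ones in auto)
  have "{p. ?g p \<noteq> 0} \<subseteq> ?A"
  proof (rule subsetI, rule ccontr)
    fix p assume p: "p \<in> {p. ?g p \<noteq> 0}" "p \<notin> ?A"
    obtain m n where mn: "p = (m, n)" by (cases p)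
    have "?g (m, n) = 0" by (rule 0) (use p(2) mn in simp)
    then show False using p(1) unfolding mn by simp
  qed
  then have "bilin_ext (diamond d) s t (Suc k) = sum ?g ?A"
    unfolding bilin_ext_def by (intro Sum_any.expand_superset) simp_all
  also have "\<dots> = (\<Sum>m\<in>Suc ` {..M}. \<Sum>n\<in>Suc ` {..N}. ?g (m, n))"
    by (simp add: sum.cartesian_product)
  also have "\<dots> = (\<Sum>m\<le>M. \<Sum>n\<le>N. ?g (Suc m, Suc n))"
    by (simp add: sum.reindex)
  finally show ?thesis by (simp add: diamond_ones del: replicate_Suc)
qed

lemma bilin_ext_diamond_nth_1: "bilin_ext (diamond d) s t 1 = s 1 * t 1"
  using bilin_ext_diamond_nth_Suc[of 0 0 0 d s t] by (simp add: shuffle_coeff_simps)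

text \<open>Terms in which one word is empty give the linear part; the recursion of the structure
  constants turns the others into the three remaining products.\<close>

lemma shift_series_bilin_ext_diamond:
  fixes s t :: tseries
  defines "s' \<equiv> shift_series s" and "t' \<equiv> shift_series t"
  shows "shift_series (bilin_ext (diamond d) s t) = (\<lambda>k.
    (s 1 * t' k + t 1 * s' k) +
    ((bilin_ext (diamond d) (prepend_one s') t' k + bilin_ext (diamond d) s' (prepend_one t') k) -
     d 1 * bilin_ext (diamond d) (prepend_one s') (prepend_one t') k))"
proof
  fix k
  show "shift_series (bilin_ext (diamond d) s t) k =
    (s 1 * t' k + t 1 * s' k) +
    ((bilin_ext (diamond d) (prepend_one s') t' k + bilin_ext (diamond d) s' (prepend_one t') k) -
     d 1 * bilin_ext (diamond d) (prepend_one s') (prepend_one t') k)"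
  proof (cases k)
    case 0
    then show ?thesis by (simp add: bilin_ext_diamond_nth_0 s'_def t'_def shift_series_def)
  next
    case (Suc q)
    let ?c = "shuffle_coeff (d 1)"
    have s': "s' (Suc m) = s (Suc (Suc m))" and t': "t' (Suc m) = t (Suc (Suc m))" for m
      by (simp_all add: s'_def t'_def shift_series_def)
    have Ps': "prepend_one s' (Suc 0) = 0" "prepend_one s' (Suc (Suc m)) = s (Suc (Suc m))"
      and Pt': "prepend_one t' (Suc 0) = 0" "prepend_one t' (Suc (Suc m)) = t (Suc (Suc m))" for m
      by (simp_all add: prepend_one_def s' t')
    have 1: "bilin_ext (diamond d) s t (Suc (Suc q)) =
        (\<Sum>n\<le>q. s 1 * t (Suc (Suc n)) * ?c 0 (Suc n) (Suc q)) +
        (\<Sum>m\<le>q. s (Suc (Suc m)) * t 1 * ?c (Suc m) 0 (Suc q)) +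
        (\<Sum>m\<le>q. \<Sum>n\<le>q. s (Suc (Suc m)) * t (Suc (Suc n)) * ?c (Suc m) (Suc n) (Suc q))"
      by (subst bilin_ext_diamond_nth_Suc[of _ "Suc q" "Suc q"])
        (simp_all add: sum.atMost_Suc_shift shuffle_coeff_simps sum.distrib del: sum.atMost_Suc)
    have 2: "(\<Sum>n\<le>q. s 1 * t (Suc (Suc n)) * ?c 0 (Suc n) (Suc q)) = s 1 * t' (Suc q)"
      "(\<Sum>m\<le>q. s (Suc (Suc m)) * t 1 * ?c (Suc m) 0 (Suc q)) = t 1 * s' (Suc q)"
      by (simp_all add: shuffle_coeff_simps s' t' mult_delta_right)
    \<comment> \<open>\<open>prepend_one\<close> has no component of length one, so a sum up to Suc
      q loses its first term and becomes a sum up to q.\<close>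
    have 3: "bilin_ext (diamond d) (prepend_one s') t' (Suc q) =
        (\<Sum>m\<le>q. \<Sum>n\<le>q. s (Suc (Suc m)) * t (Suc (Suc n)) * ?c (Suc m) n q)"
      by (subst bilin_ext_diamond_nth_Suc[of _ "Suc q" q])
        (simp_all add: sum.atMost_Suc_shift s' t' Ps' del: sum.atMost_Suc)
    have 4: "bilin_ext (diamond d) s' (prepend_one t') (Suc q) =
        (\<Sum>m\<le>q. \<Sum>n\<le>q. s (Suc (Suc m)) * t (Suc (Suc n)) * ?c m (Suc n) q)"
      by (subst bilin_ext_diamond_nth_Suc[of _ q "Suc q"])
        (simp_all add: sum.atMost_Suc_shift s' t' Pt' del: sum.atMost_Suc)
    have 5: "bilin_ext (diamond d) (prepend_one s') (prepend_one t') (Suc q) =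
        (\<Sum>m\<le>q. \<Sum>n\<le>q. s (Suc (Suc m)) * t (Suc (Suc n)) * ?c (Suc m) (Suc n) q)"
      by (subst bilin_ext_diamond_nth_Suc[of _ "Suc q" "Suc q"])
        (simp_all add: sum.atMost_Suc_shift Ps' Pt' del: sum.atMost_Suc)
    have "bilin_ext (diamond d) s t (Suc k) =
        s 1 * t' k + t 1 * s' k +
        (\<Sum>m\<le>q. \<Sum>n\<le>q. s (Suc (Suc m)) * t (Suc (Suc n)) * ?c (Suc m) (Suc n) (Suc q))"
      unfolding Suc 1 2 ..
    also have "(\<Sum>m\<le>q. \<Sum>n\<le>q. s (Suc (Suc m)) * t (Suc (Suc n)) * ?c (Suc m) (Suc n) (Suc q)) =
        (bilin_ext (diamond d) (prepend_one s') t' k + bilin_ext (diamond d) s' (prepend_one t') k) -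
        d 1 * bilin_ext (diamond d) (prepend_one s') (prepend_one t') k"
      unfolding Suc 3 4 5 shuffle_coeff_Suc
      by (simp add: algebra_simps sum.distrib sum_subtractf sum_distrib_left)
    finally show ?thesis by (simp add: shift_series_def Suc)
  qed
qed

lemma S_real_simps [simp]:
  "carrier (S_real d) = {s. s 0 = 0}" "s \<otimes>\<^bsub>S_real d\<^esub> t = bilin_ext (diamond d) s t"
  "s \<oplus>\<^bsub>S_real d\<^esub> t = (\<lambda>k. s k + t k)" "\<one>\<^bsub>S_real d\<^esub> = ptensor [1]" "\<zero>\<^bsub>S_real d\<^esub> = (\<lambda>k. 0)"
  "c \<odot>\<^bsub>S_real d\<^esub> s = (\<lambda>k. c * s k)" "filt (S_real d) n = {s. \<forall>k\<le>n. s k = 0}"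
  "der (S_real d) = lin_ext (der_S d)" "rey (S_real d) = lin_ext rey_S"
  "str (S_real d) a = ptensor [a]"
  by (simp_all add: S_real_def)

text \<open>Stated for the bare operations of \<open>S_real\<close>, whose algebra laws are not yet
  available. It serves twice: with power series for R to obtain these laws, and with arbitrary R for
  initiality.\<close>

lemma series_value_unique_cdr_hom:
  assumes cdr: "compatible_differential_reynolds_algebra real_algebra d R"
  defines "v \<equiv> filtered_reynolds_algebra.series_value R (filt R) (rey R)"
  shows "v \<in> cdr_hom real_algebra (S_real d) R"
    and "\<And>g s. g \<in> cdr_hom real_algebra (S_real d) R \<Longrightarrow> s 0 = 0 \<Longrightarrow> g s = v s"
proof -
  interpret filtered_reynolds_algebra R "filt R" "rey R" "d 1"
    by (rule cdr_imp_filtered_reynolds_algebra(1)[OF cdr])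
  have D: "k_linear R R (der R)" and DP: "\<And>x. x \<in> carrier R \<Longrightarrow> der R (rey R x) = x"
    using cdr by (auto simp: compatible_differential_reynolds_algebra_def
        differential_reynolds_algebra_def unit_modified_differential_algebra_def)
  note str = cdr_imp_filtered_reynolds_algebra(2)[OF cdr]
  note der_1 = cdr_imp_filtered_reynolds_algebra(3)[OF cdr]
  have v: "v = series_value" by (simp add: v_def)
  have one: "1 \<odot>\<^bsub>R\<^esub> \<one>\<^bsub>R\<^esub> = \<one>\<^bsub>R\<^esub>"
    using A.smult_one[of "\<one>\<^bsub>R\<^esub>"] by simp
  have mult: "series_value (bilin_ext (diamond d) s t) = series_value s \<otimes>\<^bsub>R\<^esub> series_value t" for s t
    by (rule series_value_mult, rule bilin_ext_diamond_nth_1, rule shift_series_bilin_ext_diamond)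
  have der: "series_value (lin_ext (der_S d) s) = der R (series_value s)" for s
  proof -
    let ?s = "shift_series s"
    \<comment> \<open>D removes P from the recursion, so this compatibility is an exact computation
      instead of an induction.\<close>
    have "der R (series_value s) = s 1 \<odot>\<^bsub>R\<^esub> der R \<one>\<^bsub>R\<^esub> \<oplus>\<^bsub>R\<^esub> der R (rey R (series_value ?s))"
      using D by (subst series_value_rec) (simp add: k_linear_def)
    also have "\<dots> = s 1 \<odot>\<^bsub>R\<^esub> series_value (ptensor [d 1]) \<oplus>\<^bsub>R\<^esub> series_value ?s"
      by (simp add: der_1 DP series_value_ptensor)
    finally show ?thesis
      by (simp only: lin_ext_der_S series_value_add series_value_smult)
  qed
  show "v \<in> cdr_hom real_algebra (S_real d) R"
    unfolding v cdr_hom_def algebra_hom_def ring_hom_def k_linear_def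
    using der by (simp add: one mult series_value_add series_value_smult series_value_ptensor str
        lin_ext_rey_S series_value_prepend_one image_subset_iff series_value_filt)
  fix g and s :: tseries assume g: "g \<in> cdr_hom real_algebra (S_real d) R" and s: "s 0 = 0"
  have g_closed: "g x \<in> carrier R"
    and g_rey: "g (prepend_one x) = rey R (g x)" if "x 0 = 0" for x
    using g that lin_ext_rey_S[of x] by (auto simp: cdr_hom_def algebra_hom_def ring_hom_def)
  have g_add: "g (\<lambda>k. x k + y k) = g x \<oplus>\<^bsub>R\<^esub> g y" if "x 0 = 0" "y 0 = 0" for x y
    using g that by (auto simp: cdr_hom_def algebra_hom_def ring_hom_def)
  have g_smult: "g (\<lambda>k. c * x k) = c \<odot>\<^bsub>R\<^esub> g x" if "x 0 = 0" for c x
    using g that by (auto simp: cdr_hom_def algebra_hom_def k_linear_def)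
  have g_one: "g (ptensor [1]) = \<one>\<^bsub>R\<^esub>"
    using g by (simp add: cdr_hom_def algebra_hom_def ring_hom_def str one)
  show "g s = v s"
    unfolding v
  proof (rule eq_series_valueI[where g = g and s = s, OF g_closed _ s])
    fix x :: tseries assume x: "x 0 = 0"
    have "g x = g (\<lambda>k. x 1 * ptensor [1] k + prepend_one (shift_series x) k)"
      using prepend_one_shift_series[of x] x by simp
    also have "\<dots> = x 1 \<odot>\<^bsub>R\<^esub> \<one>\<^bsub>R\<^esub> \<oplus>\<^bsub>R\<^esub> rey R (g (shift_series x))"
      by (simp add: g_add g_smult g_rey g_one tseries_nth_0)
    finally show "g x = x 1 \<odot>\<^bsub>R\<^esub> \<one>\<^bsub>R\<^esub> \<oplus>\<^bsub>R\<^esub> rey R (g (shift_series x))" .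
  qed
qed

section \<open>Power series as a faithful model of S(\<real>)\<close>

context
  fixes k h :: "real fps" and \<mu> :: real and d :: "real \<Rightarrow> real"
  assumes k0: "fps_nth k 0 \<noteq> 0" and k1: "fps_nth k 1 \<noteq> 0" and \<mu>: "\<mu> \<noteq> 0"
    and h: "h = fps_const \<mu> * fps_deriv (1 / k)" and d: "d = (\<lambda>a. inverse \<mu> * a)"
begin

interpretation PS: filtered_reynolds_algebra
  "power_series_cdr k h" "filt (power_series_cdr k h)" "P_K k h" "inverse \<mu>"
  using cdr_imp_filtered_reynolds_algebra(1)[OF compatible_power_series_cdr[OF k0 k1 \<mu> h]] by simp

definition fps_of_series :: "tseries \<Rightarrow> real fps" where "fps_of_series = PS.series_value"

lemmas D_P = D_K_P_K[OF k0 k1 \<mu> h] and P_D = P_K_D_K[OF k0 k1 \<mu> h]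
  and P_image_filt = P_K_image_filt[OF k0 k1 \<mu> h] and P_nth_0 = P_K_nth_0[OF k0 k1 \<mu> h]

lemma fps_of_series_hom: "fps_of_series \<in> cdr_hom real_algebra (S_real d) (power_series_cdr k h)"
  using series_value_unique_cdr_hom(1)[OF compatible_power_series_cdr[OF k0 k1 \<mu> h]]
  by (simp add: fps_of_series_def d)

lemma fps_of_series_rec: "fps_of_series s = fps_const (s 1) + P_K k h (fps_of_series (shift_series s))"
  using PS.series_value_rec[of s] by (simp add: fps_of_series_def)

lemma fps_of_series_nth_0: "fps_nth (fps_of_series s) 0 = s 1"
  by (subst fps_of_series_rec) (simp add: P_nth_0)

text \<open>D_K undoes P_K in the recursion, so the image of a series determines the image of its
  shift.\<close>

lemma fps_of_series_shift: "fps_of_series (shift_series s) = D_K k h (fps_of_series s - fps_const (s 1))"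
  by (subst (2) fps_of_series_rec) (simp add: D_P)

text \<open>The constant term of the image gives the first coefficient, and repeated shifts give the
  following ones.\<close>

lemma fps_of_series_inj:
  assumes "fps_of_series s = fps_of_series t" "s 0 = 0" "t 0 = 0"
  shows "s = t"
proof
  have "s (Suc n) = t (Suc n)" if "fps_of_series s = fps_of_series t" for n s t
    using that
  proof (induction n arbitrary: s t)
    case 0
    then show ?case using fps_of_series_nth_0[of s] fps_of_series_nth_0[of t] by simp
  next
    case (Suc n)
    have "s 1 = t 1" using Suc.prems fps_of_series_nth_0[of s] fps_of_series_nth_0[of t] by simp
    then have "fps_of_series (shift_series s) = fps_of_series (shift_series t)"
      using Suc.prems by (simp add: fps_of_series_shift)
    then have "shift_series s (Suc n) = shift_series t (Suc n)" by (rule Suc.IH)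
    then show ?case by (simp add: shift_series_def)
  qed
  then show "s n = t n" for n
    using assms by (cases n) auto
qed

text \<open>Counterpart of \<open>shift_series\<close>: f is its constant term plus P_K of its
  tail.\<close>

definition fps_tail :: "real fps \<Rightarrow> real fps"
  where "fps_tail f = D_K k h (f - fps_const (fps_nth f 0))"

text \<open>The coefficients of the expansion of f in the iterates P_K^j(1), read off as constant
  terms of successive tails.\<close>

definition series_of_fps :: "real fps \<Rightarrow> tseries"
  where "series_of_fps f = (\<lambda>n. if n = 0 then 0 else fps_nth ((fps_tail ^^ (n - 1)) f) 0)"

lemma shift_series_of_fps: "shift_series (series_of_fps f) = series_of_fps (fps_tail f)"
proof
  fix n
  show "shift_series (series_of_fps f) n = series_of_fps (fps_tail f) n"
    by (cases n) (simp_all add: shift_series_def series_of_fps_def funpow_swap1)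
qed

lemma series_of_fps_1: "series_of_fps f (Suc 0) = fps_nth f 0"
  by (simp add: series_of_fps_def)

text \<open>f and its reconstruction obey the same recursion along tails, so P_K improves their
  agreement by one order at each step.\<close>

lemma fps_of_series_series_of_fps: "fps_of_series (series_of_fps f) = f"
proof (rule PS.cong_filt_imp_eq)
  show "PS.cong_filt n (fps_of_series (series_of_fps f)) f" for n
  proof (induction n arbitrary: f)
    case (Suc n)
    have "f = fps_const (fps_nth f 0) + P_K k h (fps_tail f)"
      by (simp add: fps_tail_def P_D)
    moreover have "fps_of_series (series_of_fps f) =
        fps_const (fps_nth f 0) + P_K k h (fps_of_series (series_of_fps (fps_tail f)))"
      by (subst fps_of_series_rec) (simp add: shift_series_of_fps series_of_fps_1)
    moreover have "PS.cong_filt (Suc n)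
        (fps_const (fps_nth f 0) + P_K k h (fps_of_series (series_of_fps (fps_tail f))))
        (fps_const (fps_nth f 0) + P_K k h (fps_tail f))"
      using PS.cong_filt_add[OF PS.cong_filt_refl PS.cong_filt_P[OF Suc.IH]] by simp
    ultimately show ?case by metis
  qed (simp add: PS.cong_filt_0)
qed

lemma series_of_fps_0: "series_of_fps f 0 = 0"
  by (simp add: series_of_fps_def)

lemma series_of_fps_V: "s 0 = 0 \<Longrightarrow> series_of_fps (fps_of_series s) = s"
  by (rule fps_of_series_inj) (simp_all add: fps_of_series_series_of_fps series_of_fps_0)

text \<open>Makes the inverse map respect filtrations: F(n+1) = P_K(F n) allows one P_K to be
  stripped together with one leading zero coefficient.\<close>

lemma fps_of_series_filt_imp:
  assumes "fps_of_series s \<in> filt (power_series_cdr k h) n" "s 0 = 0" "i \<le> n"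
  shows "s i = 0"
  using assms
proof (induction n arbitrary: s i)
  case (Suc n)
  have s1: "s (Suc 0) = 0" using Suc.prems(1) fps_of_series_nth_0[of s] by (simp add: filt_power_series_cdr)
  obtain g where g: "g \<in> filt (power_series_cdr k h) n" "fps_of_series s = P_K k h g"
    using Suc.prems(1) P_image_filt[of n] by blast
  then have "fps_of_series (shift_series s) = g" by (simp add: fps_of_series_shift s1 D_P)
  then have "fps_of_series (shift_series s) \<in> filt (power_series_cdr k h) n" using g(1) by simp
  then have "shift_series s (i - 1) = 0" if "i > 0"
    by (rule Suc.IH) (use Suc.prems(3) in \<open>simp_all add: tseries_nth_0\<close>)
  then show ?case using Suc.prems s1 by (cases "i \<le> 1") (auto simp: shift_series_def le_Suc_eq)
qed simp

lemma fps_of_series_ops: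
  "fps_of_series (\<lambda>k. s k + t k) = fps_of_series s + fps_of_series t" "fps_of_series (\<lambda>k. s k - t k) = fps_of_series s - fps_of_series t" "fps_of_series (\<lambda>k. c * s k) = fps_const c * fps_of_series s"
  "fps_of_series (ptensor [a]) = fps_const a" "fps_of_series (\<lambda>k. 0) = 0"
  using PS.series_value_add PS.series_value_diff PS.series_value_smult PS.series_value_ptensor
    PS.series_value_zero by (simp_all add: fps_of_series_def)

lemma fps_of_series_mult: "s 0 = 0 \<Longrightarrow> t 0 = 0 \<Longrightarrow> fps_of_series (bilin_ext (diamond d) s t) = fps_of_series s * fps_of_series t"
  and fps_of_series_der: "s 0 = 0 \<Longrightarrow> fps_of_series (lin_ext (der_S d) s) = D_K k h (fps_of_series s)"
  and fps_of_series_rey: "s 0 = 0 \<Longrightarrow> fps_of_series (lin_ext rey_S s) = P_K k h (fps_of_series s)"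
  using fps_of_series_hom by (auto simp: cdr_hom_def algebra_hom_def ring_hom_def)

text \<open>\<open>fps_of_series\<close> does not see the component of length 0, so identities can
  be pulled back only between series without it.\<close>

lemma S_real_closed:
  "bilin_ext (diamond d) s t 0 = 0" "lin_ext (der_S d) s 0 = 0"
  "s 0 = 0 \<Longrightarrow> lin_ext rey_S s 0 = 0" "ptensor [a] 0 = 0"
  by (simp_all add: bilin_ext_diamond_nth_0 lin_ext_der_S lin_ext_rey_S ptensor_def shift_series_def
      prepend_one_def)

lemmas fps_of_series_simps = fps_of_series_ops fps_of_series_mult fps_of_series_der fps_of_series_rey S_real_closed

lemma k_algebra_S_real: "k_algebra (S_real d)"
proof (intro algebraI cring_base_field)
  show "cring (S_real d)"
  proof (intro cringI abelian_groupI comm_monoidI)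
    show "\<exists>y\<in>carrier (S_real d). y \<oplus>\<^bsub>S_real d\<^esub> x = \<zero>\<^bsub>S_real d\<^esub>" if "x \<in> carrier (S_real d)" for x
      using that by (intro bexI[of _ "\<lambda>k. - x k"]) simp_all
  qed (simp_all add: S_real_closed algebra_simps,
    (rule fps_of_series_inj; simp add: fps_of_series_simps algebra_simps)+)
qed (simp_all add: S_real_closed algebra_simps,
    (rule fps_of_series_inj; simp add: fps_of_series_simps algebra_simps)+)

lemma minus_S_real: "s 0 = 0 \<Longrightarrow> t 0 = 0 \<Longrightarrow> s \<ominus>\<^bsub>S_real d\<^esub> t = (\<lambda>k. s k - t k)"
proof -
  interpret algebra base_field "S_real d" by (rule k_algebra_S_real)
  show "s 0 = 0 \<Longrightarrow> t 0 = 0 \<Longrightarrow> ?thesis" by (rule a_minus_eqI) (simp_all add: is_abelian_group)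
qed

lemma compatible_S_real: "compatible_differential_reynolds_algebra real_algebra d (S_real d)"
proof (rule compatible_differential_reynolds_algebraI)
  show "differential_reynolds_algebra (S_real d) (der (S_real d)) (rey (S_real d))"
    unfolding differential_reynolds_algebra_def unit_modified_differential_algebra_def
  proof (intro conjI ballI k_algebra_S_real)
    fix x y assume "x \<in> carrier (S_real d)" "y \<in> carrier (S_real d)"
    then have x: "x 0 = 0" and y: "y 0 = 0" by simp_all
    show "der (S_real d) (x \<otimes>\<^bsub>S_real d\<^esub> y) =
        der (S_real d) x \<otimes>\<^bsub>S_real d\<^esub> y \<oplus>\<^bsub>S_real d\<^esub> x \<otimes>\<^bsub>S_real d\<^esub> der (S_real d) y \<ominus>\<^bsub>S_real d\<^esub> x \<otimes>\<^bsub>S_real d\<^esub> der (S_real d) \<one>\<^bsub>S_real d\<^esub> \<otimes>\<^bsub>S_real d\<^esub> y"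
      by (rule fps_of_series_inj)
        (use x y D_K_mult[OF k0 k1 \<mu> h, of "fps_of_series x" "fps_of_series y"] in \<open>simp_all add: fps_of_series_simps minus_S_real\<close>)
    show "rey (S_real d) x \<otimes>\<^bsub>S_real d\<^esub> rey (S_real d) y = rey (S_real d) (rey (S_real d) x \<otimes>\<^bsub>S_real d\<^esub> y) \<oplus>\<^bsub>S_real d\<^esub> rey (S_real d) (x \<otimes>\<^bsub>S_real d\<^esub> rey (S_real d) y) \<ominus>\<^bsub>S_real d\<^esub>
        rey (S_real d) (rey (S_real d) x \<otimes>\<^bsub>S_real d\<^esub> der (S_real d) \<one>\<^bsub>S_real d\<^esub> \<otimes>\<^bsub>S_real d\<^esub> rey (S_real d) y)"
      by (rule fps_of_series_inj)
        (simp_all add: x y fps_of_series_simps minus_S_real, rule P_K_reynolds[OF k0 k1 \<mu> h, of "fps_of_series x" "fps_of_series y"])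
  next
    fix x assume "x \<in> carrier (S_real d)"
    then show "der (S_real d) (rey (S_real d) x) = x"
      by (intro fps_of_series_inj) (simp_all add: fps_of_series_simps D_P)
  next
    show "k_linear (S_real d) (S_real d) (der (S_real d))" "k_linear (S_real d) (S_real d) (rey (S_real d))"
      unfolding k_linear_def
      by (auto simp: S_real_closed intro!: fps_of_series_inj)
        (simp_all add: fps_of_series_simps D_K_add[OF k0 k1 \<mu> h] D_K_const[OF k0 k1 \<mu> h]
          P_K_add[OF k0 k1 \<mu> h] P_K_const[OF k0 k1 \<mu> h])
  qed
  show "str (S_real d) \<in> algebra_hom real_algebra (S_real d)"
    by (auto simp: algebra_hom_def k_linear_def ring_hom_def S_real_closed intro!: fps_of_series_inj)
      (simp_all add: fps_of_series_simps)
  have "d a = inverse \<mu> * a" for a by (simp add: d)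
  then show "str (S_real d) (d a) = der (S_real d) (str (S_real d) a)" for a
    using D_K_const[OF k0 k1 \<mu> h, of a 1] D_K_1[OF k0 k1 \<mu> h]
    by (intro fps_of_series_inj) (simp_all add: fps_of_series_simps mult.commute)
  show "filt (S_real d) (Suc n) = rey (S_real d) ` filt (S_real d) n" for n
  proof (intro equalityI subsetI)
    fix s assume s: "s \<in> filt (S_real d) (Suc n)"
    then have "s = rey (S_real d) (shift_series s)"
      using prepend_one_shift_series[of s] by (simp add: lin_ext_rey_S tseries_nth_0)
    moreover have "shift_series s \<in> filt (S_real d) n" using s by (simp add: shift_series_def)
    ultimately show "s \<in> rey (S_real d) ` filt (S_real d) n" by blast
  next
    fix s assume "s \<in> rey (S_real d) ` filt (S_real d) n"
    then show "s \<in> filt (S_real d) (Suc n)" by (auto simp: lin_ext_rey_S prepend_one_def)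
  qed
next
  fix X :: "nat \<Rightarrow> tseries"
  assume X: "\<forall>n. X n \<in> carrier (S_real d)" "\<forall>n. X (Suc n) \<ominus>\<^bsub>S_real d\<^esub> X n \<in> filt (S_real d) n"
  then have step: "X (Suc n) i = X n i" if "i \<le> n" for n i
    using that by (simp add: minus_S_real)
  \<comment> \<open>Here consecutive terms agree up to index n inclusive, so component i is already
    final in \<open>X i\<close>.\<close>
  have "X n i = X i i" if "i \<le> n" for n i
    using that by (induction n rule: dec_induct) (simp_all add: step)
  then have "X i i - X n i = 0" if "i \<le> n" for n i
    using that by (metis diff_self)
  then show "\<exists>x\<in>carrier (S_real d). \<forall>n. x \<ominus>\<^bsub>S_real d\<^esub> X n \<in> filt (S_real d) n"
    using X(1) by (intro bexI[of _ "\<lambda>i. X i i"]) (simp_all add: minus_S_real)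
next
  fix s assume "\<forall>n. s \<in> filt (S_real d) n"
  then show "s = \<zero>\<^bsub>S_real d\<^esub>" by (auto simp: fun_eq_iff)
qed (auto simp: d unit_modified_real_algebra)

lemma cdr_isomorphic_power_series_S_real: "cdr_isomorphic real_algebra (power_series_cdr k h) (S_real d)"
  unfolding cdr_isomorphic_def
proof (intro bexI conjI ballI)
  show "fps_of_series \<in> cdr_hom real_algebra (S_real d) (power_series_cdr k h)" by (rule fps_of_series_hom)
  \<comment> \<open>Every law of the inverse map is checked by applying
    \<open>fps_of_series\<close>.\<close>
  have eqI: "series_of_fps f = s" if "f = fps_of_series s" "s 0 = 0" for f s
    using that series_of_fps_V by simp
  note simps = fps_of_series_simps fps_of_series_series_of_fps series_of_fps_0
  have add: "series_of_fps (f + g) = (\<lambda>k. series_of_fps f k + series_of_fps g k)" for f g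
    by (rule eqI) (simp_all add: simps)
  have mult: "series_of_fps (f * g) = bilin_ext (diamond d) (series_of_fps f) (series_of_fps g)" for f g
    by (rule eqI) (simp_all add: simps)
  have smult: "series_of_fps (fps_const c * f) = (\<lambda>k. c * series_of_fps f k)" for c f
    by (rule eqI) (simp_all add: simps)
  have const: "series_of_fps (fps_const a) = ptensor [a]" for a
    by (rule eqI) (simp_all add: simps)
  \<comment> \<open>Scalar multiplication of power series is a product with a constant, so rewriting
    with \<open>mult\<close> also affects it; this equation reconciles the two forms.\<close>
  have scalar_mult: "bilin_ext (diamond d) (ptensor [c]) (series_of_fps f) =
      (\<lambda>k. c * series_of_fps f k)" for c f
    using smult[of c f] by (simp only: mult const)
  have one: "series_of_fps 1 = ptensor [1]"
    using const[of 1] by simp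
  have der: "series_of_fps (D_K k h f) = lin_ext (der_S d) (series_of_fps f)" for f
    by (rule eqI) (simp_all add: simps)
  have rey: "series_of_fps (P_K k h f) = lin_ext rey_S (series_of_fps f)" for f
    by (rule eqI) (simp_all add: simps)
  have filt: "series_of_fps f i = 0" if "f \<in> filt (power_series_cdr k h) n" "i \<le> n" for f n i
    using fps_of_series_filt_imp[of "series_of_fps f" n] that by (simp add: fps_of_series_series_of_fps series_of_fps_0)
  show "series_of_fps \<in> cdr_hom real_algebra (power_series_cdr k h) (S_real d)"
    by (simp add: cdr_hom_def algebra_hom_def ring_hom_def k_linear_def series_of_fps_0
        image_subset_iff add mult scalar_mult const one der rey filt)
qed (simp_all add: fps_of_series_series_of_fps series_of_fps_V)

end

section \<open>Initiality of S(\<real>) and the final result\<close>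

text \<open>Morphisms are total functions of which only the values on the carrier matter; this
  allows passing to a restriction.\<close>

lemma cdr_hom_cong:
  assumes "f \<in> cdr_hom A R R'" and "\<And>x. x \<in> carrier R \<Longrightarrow> g x = f x"
    and "\<And>x y. x \<in> carrier R \<Longrightarrow> y \<in> carrier R \<Longrightarrow> x \<otimes>\<^bsub>R\<^esub> y \<in> carrier R"
    and "\<And>x y. x \<in> carrier R \<Longrightarrow> y \<in> carrier R \<Longrightarrow> x \<oplus>\<^bsub>R\<^esub> y \<in> carrier R"
    and "\<And>c x. x \<in> carrier R \<Longrightarrow> c \<odot>\<^bsub>R\<^esub> x \<in> carrier R"
    and "\<one>\<^bsub>R\<^esub> \<in> carrier R" and "\<And>a. a \<in> carrier A \<Longrightarrow> str R a \<in> carrier R"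
    and "\<And>x. x \<in> carrier R \<Longrightarrow> der R x \<in> carrier R"
    and "\<And>x. x \<in> carrier R \<Longrightarrow> rey R x \<in> carrier R"
    and "\<And>n x. x \<in> filt R n \<Longrightarrow> x \<in> carrier R"
  shows "g \<in> cdr_hom A R R'"
proof -
  have "g ` filt R n = f ` filt R n" for n
    by (rule image_cong[OF refl]) (rule assms(2)[OF assms(10)])
  then show ?thesis
    using assms(1) by (simp add: cdr_hom_def algebra_hom_def ring_hom_def k_linear_def Pi_iff assms(2-9))
qed

text \<open>Unique existence among extensional functions expresses initiality, since it fixes the
  arbitrary values outside the carrier.\<close>

theorem proposition3p14:
  fixes k h :: "real fps" and \<mu> :: real and d :: "real \<Rightarrow> real"
  assumes "fps_nth k 0 \<noteq> 0" and "fps_nth k 1 \<noteq> 0" and "\<mu> \<noteq> 0"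
    and "h = fps_const \<mu> * fps_deriv (1 / k)"
    and "d = (\<lambda>a. inverse \<mu> * a)"
  shows "compatible_differential_reynolds_algebra real_algebra d (power_series_cdr k h)
    \<and> compatible_differential_reynolds_algebra real_algebra d (S_real d)
    \<and> (\<forall>R :: (real, real, 'r) cdr_algebra.
         compatible_differential_reynolds_algebra real_algebra d R \<longrightarrow>
         (\<exists>!f. f \<in> cdr_hom real_algebra (S_real d) R \<and> f \<in> extensional (carrier (S_real d))))
    \<and> cdr_isomorphic real_algebra (power_series_cdr k h) (S_real d)"
proof (intro conjI allI impI)
  show "compatible_differential_reynolds_algebra real_algebra d (power_series_cdr k h)"
    unfolding assms(5) by (rule compatible_power_series_cdr[OF assms(1-4)])
  show S: "compatible_differential_reynolds_algebra real_algebra d (S_real d)"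
    by (rule compatible_S_real[OF assms])
  show "cdr_isomorphic real_algebra (power_series_cdr k h) (S_real d)"
    by (rule cdr_isomorphic_power_series_S_real[OF assms])
  fix R :: "(real, real, 'r) cdr_algebra"
  assume R: "compatible_differential_reynolds_algebra real_algebra d R"
  define v where "v = filtered_reynolds_algebra.series_value R (filt R) (rey R)"
  note v = series_value_unique_cdr_hom[OF R, folded v_def]
  show "\<exists>!f. f \<in> cdr_hom real_algebra (S_real d) R \<and> f \<in> extensional (carrier (S_real d))"
  proof (intro ex1I conjI)
    show "restrict v (carrier (S_real d)) \<in> cdr_hom real_algebra (S_real d) R"
      by (rule cdr_hom_cong[OF v(1)])
        (simp_all add: bilin_ext_diamond_nth_0 lin_ext_der_S lin_ext_rey_S tseries_nth_0)
    show "restrict v (carrier (S_real d)) \<in> extensional (carrier (S_real d))"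
      by (rule restrict_extensional)
    fix g
    assume g: "g \<in> cdr_hom real_algebra (S_real d) R \<and> g \<in> extensional (carrier (S_real d))"
    show "g = restrict v (carrier (S_real d))"
    proof (rule extensionalityI)
      fix s assume "s \<in> carrier (S_real d)"
      then show "g s = restrict v (carrier (S_real d)) s" using g v(2)[of g s] by simp
    qed (use g in auto)
  qed
qed

end
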